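(* Fix $K\ge2$. For each $n$ let $P=P_n\in\mathbb R^{K\times K}$ be a symmetric matrix with entries in $[0,1]$, let $F=F_n$ be a distribution on the probability simplex of $\mathbb R^K$, let $h=h_n=\mathbb E_{\pi\sim F}[\pi]$, and let $\alpha_0=h'Ph$. Consider the sequence, indexed by $n$, of pairs of hypotheses on the symmetric zero-diagonal random adjacency matrix $A\in\{0,1\}^{n\times n}$: $$H_0^{(n)}:\ \Omega=\alpha_0\mathbf 1_n\mathbf 1_n';\qquad H_1^{(n)}:\ \Omega=\Pi P\Pi',\ \ \Pi=[\pi_1,\dots,\pi_n]',\ \ \pi_i\overset{iid}{\sim}F,$$ where, given $\Omega$, the entries $A_{ij}$, $i<j$, are independent Bernoulli$(\Omega_{ij})$. Let $$\beta_n=\beta_n(K,P_n,h_n)=\max\bigl\{n^{3/2}\alpha_0^{-1}\|Ph-\alpha_0\mathbf 1_K\|^2,\ \ n^2\alpha_0^{-2}\|P-\alpha_0\mathbf 1_K\mathbf 1_K'\|^4\bigr\}.$$ If $\beta_n\to0$, then the chi-square distance between the two hypotheses converges to $0$ as $n\to\infty$.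
   Context: $\mathbf 1_m$ is the all-ones vector in $\mathbb R^m$; $\|\cdot\|$ is the Euclidean norm of a vector or operator norm of a matrix. The chi-square distance between the two hypotheses is $\int\bigl[\frac{f_1(A)}{f_0(A)}-1\bigr]^2f_0(A)\,dA$, where $f_0$ and $f_1$ are the probability densities (mass functions) of $A$ under $H_0^{(n)}$ and under $H_1^{(n)}$ (marginalized over the random $\Pi$), respectively.
   Formalization: Added: $\alpha_0\le 1-c$ for some fixed $c>0$ and all large $n$. Without it the claim fails: $K=2$, $F$ uniform on $\{e_1,e_2\}$, $P$ with diagonal $1$, off-diagonal $1-2n^{-3/4}$ gives $\beta_n\to0$ but chi-square distance $\to\infty$. *)

theory Defs
  imports "HOL-Probability.Probability"
begin

unbundle vec_syntax

section \<open>Mixed membership parameters\<close>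

definition prob_simplex :: "(real ^ 'k) set" where
  "prob_simplex = {x. (\<forall>k. 0 \<le> x $ k) \<and> (\<Sum>k\<in>UNIV. x $ k) = 1}"

definition distribution_on_simplex :: "(real ^ 'k) measure \<Rightarrow> bool" where
  "distribution_on_simplex F \<longleftrightarrow>
     prob_space F \<and> sets F = sets borel \<and> (AE x in F. x \<in> prob_simplex)"

definition mean_membership :: "(real ^ 'k) measure \<Rightarrow> real ^ 'k" where
  "mean_membership F = (\<integral>x. x \<partial>F)"

definition alpha0 :: "real ^ 'k ^ 'k \<Rightarrow> real ^ 'k \<Rightarrow> real" where
  "alpha0 P h = h \<bullet> (P *v h)"

definition ones_vec :: "real ^ 'k" where
  "ones_vec = (\<chi> i. 1)"

definition ones_mat :: "real ^ 'k ^ 'k" where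
  "ones_mat = (\<chi> i j. 1)"

text \<open>
  If \<open>alpha0 P h = 0\<close>, the divisions below return \<open>0\<close>. This is harmless: in that case almost surely
  all off-diagonal entries of \<open>\<Omega>\<close> vanish under the alternative, so the two hypotheses coincide.
\<close>

definition beta_n :: "nat \<Rightarrow> real ^ 'k ^ 'k \<Rightarrow> real ^ 'k \<Rightarrow> real" where
  "beta_n n P h =
     max (real n powr (3/2) * inverse (alpha0 P h) *
            norm (P *v h - alpha0 P h *\<^sub>R ones_vec) ^ 2)
         (real n ^ 2 * inverse (alpha0 P h ^ 2) *
            onorm ((*v) (P - alpha0 P h *\<^sub>R ones_mat)) ^ 4)"


section \<open>Random adjacency matrices\<close>

text \<open>
  An \<open>n \<times> n\<close> matrix is a function on pairs of indices from \<open>{..<n}\<close>, extended by \<open>0\<close>.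
\<close>

definition adjacency_matrices :: "nat \<Rightarrow> (nat \<Rightarrow> nat \<Rightarrow> nat) set" where
  "adjacency_matrices n =
     {A. (\<forall>i j. A i j \<in> {0, 1}) \<and> (\<forall>i j. A i j = A j i) \<and> (\<forall>i. A i i = 0) \<and>
         (\<forall>i j. \<not> (i < n \<and> j < n) \<longrightarrow> A i j = 0)}"

definition upper_pairs :: "nat \<Rightarrow> (nat \<times> nat) set" where
  "upper_pairs n = {(i, j). i < j \<and> j < n}"

text \<open>
  Here \<open>e\<close> is \<open>False\<close> outside \<open>upper_pairs n\<close>, so at most one of the two disjuncts can hold.
\<close>

definition symmetric_adjacency :: "(nat \<times> nat \<Rightarrow> bool) \<Rightarrow> nat \<Rightarrow> nat \<Rightarrow> nat" where
  "symmetric_adjacency e = (\<lambda>i j. of_bool (e (i, j) \<or> e (j, i)))"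

definition adjacency_pmf :: "nat \<Rightarrow> (nat \<Rightarrow> nat \<Rightarrow> real) \<Rightarrow> (nat \<Rightarrow> nat \<Rightarrow> nat) pmf" where
  "adjacency_pmf n \<Omega> =
     map_pmf symmetric_adjacency
       (Pi_pmf (upper_pairs n) False (\<lambda>(i, j). bernoulli_pmf (\<Omega> i j)))"

lemma finite_upper_pairs: "finite (upper_pairs n)"
  by (rule finite_subset[of _ "{..<n} \<times> {..<n}"]) (auto simp: upper_pairs_def)

lemma set_adjacency_pmf: "set_pmf (adjacency_pmf n \<Omega>) \<subseteq> adjacency_matrices n"
proof -
  have "set_pmf (Pi_pmf (upper_pairs n) False (\<lambda>(i, j). bernoulli_pmf (\<Omega> i j)))
          \<subseteq> {e. \<forall>x. x \<notin> upper_pairs n \<longrightarrow> e x = False}"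
    using set_Pi_pmf_subset[OF finite_upper_pairs] by fast
  moreover have "symmetric_adjacency e \<in> adjacency_matrices n"
    if "\<forall>x. x \<notin> upper_pairs n \<longrightarrow> e x = False" for e
    using that by (auto simp: symmetric_adjacency_def adjacency_matrices_def upper_pairs_def)
  ultimately show ?thesis
    by (auto simp: adjacency_pmf_def)
qed

lemma finite_adjacency_matrices: "finite (adjacency_matrices n)"
proof -
  let ?B = "{g :: nat \<times> nat \<Rightarrow> nat. \<forall>x. (x \<in> {..<n} \<times> {..<n} \<longrightarrow> g x \<in> {0, 1}) \<and>
              (x \<notin> {..<n} \<times> {..<n} \<longrightarrow> g x = 0)}"
  have "finite ?B"
    by (rule finite_set_of_finite_funs) auto
  moreover have "adjacency_matrices n \<subseteq> curry ` ?B"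
  proof
    fix A assume "A \<in> adjacency_matrices n"
    then have "case_prod A \<in> ?B" "A = curry (case_prod A)"
      by (auto simp: adjacency_matrices_def)
    then show "A \<in> curry ` ?B" by blast
  qed
  ultimately show ?thesis
    by (rule finite_surj)
qed


section \<open>The two hypotheses and their chi-square distance\<close>

definition null_density ::
    "nat \<Rightarrow> real ^ 'k ^ 'k \<Rightarrow> (real ^ 'k) measure \<Rightarrow> (nat \<Rightarrow> nat \<Rightarrow> nat) \<Rightarrow> real" where
  "null_density n P F A =
     pmf (adjacency_pmf n (\<lambda>i j. alpha0 P (mean_membership F))) A"

text \<open>
  The rows \<open>\<pi> i\<close>, \<open>i < n\<close>, of the membership matrix are i.i.d. with law \<open>F\<close>, and are integrated out.
\<close>

definition alternative_density ::
    "nat \<Rightarrow> real ^ 'k ^ 'k \<Rightarrow> (real ^ 'k) measure \<Rightarrow> (nat \<Rightarrow> nat \<Rightarrow> nat) \<Rightarrow> real" where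
  "alternative_density n P F A =
     (\<integral>\<pi>. pmf (adjacency_pmf n (\<lambda>i j. \<pi> i \<bullet> (P *v \<pi> j))) A \<partial>(\<Pi>\<^sub>M i\<in>{..<n}. F))"

definition chi_square_distance ::
    "nat \<Rightarrow> real ^ 'k ^ 'k \<Rightarrow> (real ^ 'k) measure \<Rightarrow> real" where
  "chi_square_distance n P F =
     (\<Sum>A\<in>adjacency_matrices n.
        (alternative_density n P F A / null_density n P F A - 1) ^ 2 * null_density n P F A)"

text \<open>
  The theorem assumes that \<open>alpha0\<close> stays away from \<open>1\<close>. Some such condition is needed, because the
  factor \<open>1 - alpha0\<close> of the Bernoulli variance does not enter \<open>beta_n\<close>: let \<open>F\<close> be uniform on the
  two unit vectors of \<open>\<real>\<^sup>2\<close>, and let \<open>P\<close> have diagonal entries \<open>1\<close> and off-diagonal entries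
  \<open>1 - 2\<epsilon>\<close> with \<open>\<epsilon> = n powr (-3/4)\<close>. Then \<open>alpha0 = 1 - \<epsilon>\<close> and \<open>beta_n = 16 n\<^sup>2 \<epsilon>\<^sup>4 / (1 - \<epsilon>)\<^sup>2\<close>
  tends to \<open>0\<close>. The event that the vertices split into two (possibly empty) cliques has probability \<open>1\<close>
  under the alternative. Under the null hypothesis, a union bound over the \<open>2\<^sup>n\<close> splits, each
  containing at least \<open>n (n - 2) / 4\<close> pairs within cliques, bounds its probability by
  \<open>exp (n ln 2 - \<epsilon> n (n - 2) / 4)\<close>, which tends to \<open>0\<close>. So the chi-square distance tends to
  infinity.
\<close>

end

theory Submission
  imports Defs
begin

text \<open>
  One plus the chi-square distance is the second moment of the likelihood ratio under the null
  hypothesis. Writing the squared mixture as an integral over two independent membership matrices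
  with rows \<open>\<pi> i\<close> and \<open>\<rho> i\<close>, and summing over the independent entries of \<open>A\<close>, turns it into the
  expectation of
  \<open>\<Prod>i<j. 1 + \<gamma> (\<pi> i \<bullet> M \<pi> j) (\<rho> i \<bullet> M \<rho> j)\<close>, where \<open>\<alpha> = alpha0 P h\<close>, \<open>\<gamma> = 1 / (\<alpha> (1 - \<alpha>))\<close> and \<open>M\<close> is
  \<open>P\<close> minus the constant matrix \<open>\<alpha>\<close>. Since \<open>1 + x \<le> exp x\<close>, it is enough to control the exponential
  moment of \<open>S = \<gamma> \<Sum>i<j. (\<pi> i \<bullet> M \<pi> j) (\<rho> i \<bullet> M \<rho> j)\<close>.

  Up to a diagonal of size at most \<open>\<gamma> n \<parallel>M\<parallel>\<^sup>2 / 2\<close>, the sum \<open>S\<close> is \<open>\<gamma> / 2\<close> times the quadratic form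
  \<open>T \<bullet> M T M\<close> at the matrix \<open>T = \<Sum>i. \<pi> i (\<rho> i)'\<close>, whose mean is \<open>n h h'\<close>. Put \<open>R = T - n h h'\<close>.
  Because \<open>h \<bullet> M h = 0\<close>, the term of order \<open>n\<^sup>2\<close> vanishes, and with \<open>M h = P h - \<alpha> 1\<close> one obtains
  \<open>S \<le> \<gamma> n \<parallel>M h\<parallel>\<^sup>2 \<parallel>R\<parallel> + \<gamma> \<parallel>M\<parallel>\<^sup>2 \<parallel>R\<parallel>\<^sup>2 / 2 + \<gamma> n \<parallel>M\<parallel>\<^sup>2 / 2\<close>
  (\<open>sum_upper_pairs_bilinear_product_le\<close>), with the Frobenius norm of \<open>R\<close>. Every entry of \<open>R\<close> is a sum
  of \<open>n\<close> independent centred variables in \<open>[-1, 1]\<close>, so \<open>\<parallel>R\<parallel>\<close> is typically of order \<open>\<surd>n\<close>, and the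
  first two terms are of order \<open>\<gamma> n powr (3/2) \<parallel>M h\<parallel>\<^sup>2\<close> and \<open>\<gamma> n \<parallel>M\<parallel>\<^sup>2\<close>. As \<open>\<alpha>\<close> stays away from \<open>1\<close>,
  these are at most constant multiples of \<open>beta_n\<close> and its square root.

  To make this precise for exponential moments, the linear term is absorbed into the quadratic one
  by the inequality of arithmetic and geometric means. This leaves \<open>n \<theta> + \<theta> \<parallel>R\<parallel>\<^sup>2\<close> with
  \<open>n \<theta>\<close> tending to \<open>0\<close>. Jensen's inequality reduces \<open>\<parallel>R\<parallel>\<^sup>2\<close> to a single entry of \<open>R\<close>, and the
  exponential moment of the square of one entry is bounded by removing its summands one at a time
  with Hoeffding's lemma (\<open>nn_integral_exp_square_sum_le\<close>). If \<open>\<alpha> = 0\<close>, where \<open>\<gamma>\<close> is meaningless, both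
  hypotheses almost surely produce the empty graph (\<open>chi_square_distance_eq_0\<close>).
\<close>


section \<open>The second moment of the likelihood ratio\<close>

lemma symmetric_adjacency_upper_entries:
  assumes "A \<in> adjacency_matrices n"
  shows "symmetric_adjacency (\<lambda>p. p \<in> upper_pairs n \<and> A (fst p) (snd p) = 1) = A"
proof (intro ext)
  fix i j
  have A: "A i j = 0 \<or> A i j = 1" "A j i = A i j" "A i i = 0"
      "\<not> (i < n \<and> j < n) \<Longrightarrow> A i j = 0"
    using assms by (auto simp: adjacency_matrices_def)
  show "symmetric_adjacency (\<lambda>p. p \<in> upper_pairs n \<and> A (fst p) (snd p) = 1) i j = A i j"
    using A by (cases i j rule: linorder_cases) (auto simp: symmetric_adjacency_def upper_pairs_def)
qed

text \<open>
  The upper triangle determines \<open>A\<close>, so exactly one edge configuration in the support of the product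
  distribution is sent to \<open>A\<close>.
\<close>
lemma pmf_adjacency_pmf:
  assumes A: "A \<in> adjacency_matrices n"
  shows "pmf (adjacency_pmf n \<Omega>) A =
    (\<Prod>(i, j)\<in>upper_pairs n. pmf (bernoulli_pmf (\<Omega> i j)) (A i j = 1))"
proof -
  let ?D = "Pi_pmf (upper_pairs n) False (\<lambda>(i, j). bernoulli_pmf (\<Omega> i j))"
  define e where "e p \<longleftrightarrow> p \<in> upper_pairs n \<and> A (fst p) (snd p) = 1" for p
  have e_outside: "e p = False" if "p \<notin> upper_pairs n" for p
    using that by (simp add: e_def)
  have sym_e: "symmetric_adjacency e = A"
    unfolding e_def by (rule symmetric_adjacency_upper_entries[OF A])
  have "symmetric_adjacency -` {A} \<inter> set_pmf ?D = {e} \<inter> set_pmf ?D"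
  proof -
    have "f = e" if "f \<in> set_pmf ?D" "symmetric_adjacency f = A" for f
    proof
      fix p :: "nat \<times> nat"
      obtain i j where p: "p = (i, j)" by (cases p)
      have f: "\<And>q. q \<notin> upper_pairs n \<Longrightarrow> \<not> f q"
        using that(1) set_Pi_pmf_subset[OF finite_upper_pairs] by fast
      show "f p = e p"
      proof (cases "p \<in> upper_pairs n")
        case True
        then have "\<not> f (j, i)" by (intro f) (auto simp: p upper_pairs_def)
        moreover have "A i j = of_bool (f (i, j) \<or> f (j, i))"
          using that(2) by (auto simp: symmetric_adjacency_def)
        ultimately show ?thesis using True by (simp add: e_def p)
      qed (simp add: f e_def)
    qed
    with sym_e show ?thesis by auto
  qed
  then have "pmf (adjacency_pmf n \<Omega>) A = measure ?D {e}"
    unfolding adjacency_pmf_def pmf_map by (metis measure_Int_set_pmf)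
  also have "\<dots> = (\<Prod>(i, j)\<in>upper_pairs n. pmf (bernoulli_pmf (\<Omega> i j)) (e (i, j)))"
    by (simp add: measure_pmf_single pmf_Pi'[OF finite_upper_pairs e_outside] split_def)
  also have "\<dots> = (\<Prod>(i, j)\<in>upper_pairs n. pmf (bernoulli_pmf (\<Omega> i j)) (A i j = 1))"
    by (intro prod.cong) (auto simp: e_def)
  finally show ?thesis .
qed

text \<open>
  Symmetric zero-one matrices with zero diagonal correspond to arbitrary zero-one labellings of the
  upper triangle, so the sum of products factorises by distributivity.
\<close>
lemma sum_adjacency_matrices_prod:
  fixes f :: "nat \<times> nat \<Rightarrow> bool \<Rightarrow> real"
  shows "(\<Sum>A\<in>adjacency_matrices n. \<Prod>(i, j)\<in>upper_pairs n. f (i, j) (A i j = 1)) =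
    (\<Prod>p\<in>upper_pairs n. f p False + f p True)"
proof -
  let ?U = "upper_pairs n"
  have "(\<Sum>A\<in>adjacency_matrices n. \<Prod>(i, j)\<in>?U. f (i, j) (A i j = 1)) =
      (\<Sum>g\<in>Pi\<^sub>E ?U (\<lambda>_. UNIV). \<Prod>p\<in>?U. f p (g p))"
  proof (rule sum.reindex_bij_witness[where
        i = "\<lambda>g. symmetric_adjacency (\<lambda>p. p \<in> ?U \<and> g p)" and
        j = "\<lambda>A. \<lambda>p\<in>?U. A (fst p) (snd p) = 1"])
    fix A assume A: "A \<in> adjacency_matrices n"
    have "(\<lambda>p. p \<in> ?U \<and> (\<lambda>p\<in>?U. A (fst p) (snd p) = 1) p) =
        (\<lambda>p. p \<in> ?U \<and> A (fst p) (snd p) = 1)"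
      by auto
    then show "symmetric_adjacency (\<lambda>p. p \<in> ?U \<and> (\<lambda>p\<in>?U. A (fst p) (snd p) = 1) p) = A"
      using symmetric_adjacency_upper_entries[OF A] by simp
    show "(\<Prod>p\<in>?U. f p ((\<lambda>p\<in>?U. A (fst p) (snd p) = 1) p)) =
        (\<Prod>(i, j)\<in>?U. f (i, j) (A i j = 1))"
      by (intro prod.cong) auto
  next
    fix g assume g: "g \<in> Pi\<^sub>E ?U (\<lambda>_. UNIV :: bool set)"
    show "(\<lambda>p\<in>?U. symmetric_adjacency (\<lambda>p. p \<in> ?U \<and> g p) (fst p) (snd p) = 1) = g"
      using g by (intro ext) (auto simp: symmetric_adjacency_def upper_pairs_def PiE_def extensional_def)
    show "symmetric_adjacency (\<lambda>p. p \<in> ?U \<and> g p) \<in> adjacency_matrices n"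
      by (auto simp: symmetric_adjacency_def adjacency_matrices_def upper_pairs_def)
  qed auto
  also have "\<dots> = (\<Prod>p\<in>?U. \<Sum>b\<in>UNIV. f p b)"
    by (rule prod_sum_PiE[symmetric]) (auto simp: finite_upper_pairs)
  finally show ?thesis by (simp add: UNIV_bool)
qed

text \<open>
  The left-hand side is the expectation, under a Bernoulli variable with parameter \<open>a\<close>, of the product
  of the likelihood ratios of the parameters \<open>p\<close> and \<open>q\<close>.
\<close>
lemma bernoulli_cross_moment:
  fixes a p q :: real
  assumes "0 < a" "a < 1"
  shows "(1 - p) * (1 - q) / (1 - a) + p * q / a = 1 + (p - a) * (q - a) / (a * (1 - a))"
  using assms by (simp add: field_simps)

lemma sum_adjacency_pmf_mult_div:
  assumes a: "0 < a" "a < 1"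
    and \<Omega>: "\<And>i j. (i, j) \<in> upper_pairs n \<Longrightarrow> \<Omega> i j \<in> {0..1} \<and> \<Omega>' i j \<in> {0..1}"
  shows "(\<Sum>A\<in>adjacency_matrices n.
      pmf (adjacency_pmf n \<Omega>) A * pmf (adjacency_pmf n \<Omega>') A / pmf (adjacency_pmf n (\<lambda>i j. a)) A) =
    (\<Prod>(i, j)\<in>upper_pairs n. 1 + (\<Omega> i j - a) * (\<Omega>' i j - a) / (a * (1 - a)))"
proof -
  define f where "f p b = pmf (bernoulli_pmf (case_prod \<Omega> p)) b * pmf (bernoulli_pmf (case_prod \<Omega>' p)) b
    / pmf (bernoulli_pmf a) b" for p b
  have "(\<Sum>A\<in>adjacency_matrices n.
      pmf (adjacency_pmf n \<Omega>) A * pmf (adjacency_pmf n \<Omega>') A / pmf (adjacency_pmf n (\<lambda>i j. a)) A) =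
    (\<Sum>A\<in>adjacency_matrices n. \<Prod>(i, j)\<in>upper_pairs n. f (i, j) (A i j = 1))"
    by (intro sum.cong refl)
      (simp add: pmf_adjacency_pmf f_def split_def flip: prod.distrib prod_dividef)
  also have "\<dots> = (\<Prod>p\<in>upper_pairs n. f p False + f p True)"
    by (rule sum_adjacency_matrices_prod)
  also have "\<dots> = (\<Prod>(i, j)\<in>upper_pairs n. 1 + (\<Omega> i j - a) * (\<Omega>' i j - a) / (a * (1 - a)))"
  proof (intro prod.cong refl)
    fix p assume p: "p \<in> upper_pairs n"
    obtain i j where ij: "p = (i, j)" by (cases p)
    have "f p False + f p True = (1 - \<Omega> i j) * (1 - \<Omega>' i j) / (1 - a) + \<Omega> i j * \<Omega>' i j / a"
      using \<Omega>[of i j] p a by (simp add: f_def ij)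
    also have "\<dots> = 1 + (\<Omega> i j - a) * (\<Omega>' i j - a) / (a * (1 - a))"
      by (rule bernoulli_cross_moment[OF a])
    finally show "f p False + f p True =
        (case p of (i, j) \<Rightarrow> 1 + (\<Omega> i j - a) * (\<Omega>' i j - a) / (a * (1 - a)))"
      by (simp add: ij)
  qed
  finally show ?thesis .
qed

lemma sum_adjacency_pmf_mult_div_le_exp:
  assumes a: "0 < a" "a < 1"
    and \<Omega>: "\<And>i j. (i, j) \<in> upper_pairs n \<Longrightarrow> \<Omega> i j \<in> {0..1} \<and> \<Omega>' i j \<in> {0..1}"
  shows "(\<Sum>A\<in>adjacency_matrices n.
      pmf (adjacency_pmf n \<Omega>) A * pmf (adjacency_pmf n \<Omega>') A / pmf (adjacency_pmf n (\<lambda>i j. a)) A)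
    \<le> exp ((\<Sum>(i, j)\<in>upper_pairs n. (\<Omega> i j - a) * (\<Omega>' i j - a)) / (a * (1 - a)))"
proof -
  have "(\<Prod>(i, j)\<in>upper_pairs n. 1 + (\<Omega> i j - a) * (\<Omega>' i j - a) / (a * (1 - a)))
      \<le> (\<Prod>(i, j)\<in>upper_pairs n. exp ((\<Omega> i j - a) * (\<Omega>' i j - a) / (a * (1 - a))))"
  proof (intro prod_mono, safe)
    fix i j assume "(i, j) \<in> upper_pairs n"
    then have "0 \<le> (1 - \<Omega> i j) * (1 - \<Omega>' i j) / (1 - a) + \<Omega> i j * \<Omega>' i j / a"
      using \<Omega>[of i j] a by simp
    also have "\<dots> = 1 + (\<Omega> i j - a) * (\<Omega>' i j - a) / (a * (1 - a))"
      by (rule bernoulli_cross_moment[OF a])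
    finally show "0 \<le> 1 + (\<Omega> i j - a) * (\<Omega>' i j - a) / (a * (1 - a))" .
  qed (rule exp_ge_add_one_self)
  also have "\<dots> = exp ((\<Sum>(i, j)\<in>upper_pairs n. (\<Omega> i j - a) * (\<Omega>' i j - a)) / (a * (1 - a)))"
    by (simp add: split_def sum_divide_distrib exp_sum finite_upper_pairs)
  finally show ?thesis
    using sum_adjacency_pmf_mult_div[OF assms] by simp
qed

text \<open>
  Membership vectors lie in the simplex only almost surely. The clamped formula is valid for every
  real parameter, and so gives measurability in the membership vectors everywhere.
\<close>
lemma pmf_bernoulli_clamp:
  "pmf (bernoulli_pmf p) b = (if b then min 1 (max 0 p) else 1 - min 1 (max 0 p))"
proof -
  interpret pmf_as_function .
  show ?thesis by transfer simp
qed

lemma alternative_likelihood_measurable: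
  fixes P :: "real ^ 'k ^ 'k"
  assumes "sets F = sets borel" and A: "A \<in> adjacency_matrices n"
  shows "(\<lambda>\<pi>. pmf (adjacency_pmf n (\<lambda>i j. \<pi> i \<bullet> (P *v \<pi> j))) A) \<in> borel_measurable (\<Pi>\<^sub>M i\<in>{..<n}. F)"
proof -
  have [measurable_cong]: "sets (\<Pi>\<^sub>M i\<in>{..<n}. F) = sets (\<Pi>\<^sub>M i\<in>{..<n}. borel)"
    using assms by (intro sets_PiM_cong) auto
  have [measurable]: "(*v) P \<in> borel_measurable borel"
    by (intro borel_measurable_continuous_onI linear_continuous_on matrix_vector_mul_bounded_linear)
  have [measurable]: "(\<lambda>\<pi>. pmf (bernoulli_pmf (\<pi> i \<bullet> (P *v \<pi> j))) b) \<in> borel_measurable (\<Pi>\<^sub>M i\<in>{..<n}. F)"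
    if "(i, j) \<in> upper_pairs n" for i j b
  proof -
    have [measurable]: "i \<in> {..<n}" "j \<in> {..<n}" using that by (auto simp: upper_pairs_def)
    show ?thesis unfolding pmf_bernoulli_clamp by measurable
  qed
  show ?thesis
    unfolding pmf_adjacency_pmf[OF A] split_def
    by (intro borel_measurable_prod) auto
qed

lemma ennreal_alternative_density:
  fixes P :: "real ^ 'k ^ 'k"
  assumes F: "distribution_on_simplex F" and A: "A \<in> adjacency_matrices n"
  shows "ennreal (alternative_density n P F A) =
    (\<integral>\<^sup>+\<pi>. ennreal (pmf (adjacency_pmf n (\<lambda>i j. \<pi> i \<bullet> (P *v \<pi> j))) A) \<partial>(\<Pi>\<^sub>M i\<in>{..<n}. F))"
proof -
  interpret prob_space "\<Pi>\<^sub>M i\<in>{..<n}. F"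
    using F by (intro prob_space_PiM) (simp add: distribution_on_simplex_def)
  have "integrable (\<Pi>\<^sub>M i\<in>{..<n}. F) (\<lambda>\<pi>. pmf (adjacency_pmf n (\<lambda>i j. \<pi> i \<bullet> (P *v \<pi> j))) A)"
    using F A
    by (intro integrable_const_bound[where B = 1] alternative_likelihood_measurable)
      (auto simp: distribution_on_simplex_def pmf_le_1)
  then show ?thesis
    unfolding alternative_density_def by (intro nn_integral_eq_integral[symmetric]) auto
qed

lemma sum_alternative_density:
  fixes P :: "real ^ 'k ^ 'k"
  assumes F: "distribution_on_simplex F"
  shows "(\<Sum>A\<in>adjacency_matrices n. alternative_density n P F A) = 1"
proof -
  interpret prob_space "\<Pi>\<^sub>M i\<in>{..<n}. F"
    using F by (intro prob_space_PiM) (simp add: distribution_on_simplex_def)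
  have nonneg: "alternative_density n P F A \<ge> 0" for A
    unfolding alternative_density_def by (intro integral_nonneg_AE) auto
  have "ennreal (\<Sum>A\<in>adjacency_matrices n. alternative_density n P F A) =
      (\<Sum>A\<in>adjacency_matrices n. \<integral>\<^sup>+\<pi>. ennreal (pmf (adjacency_pmf n (\<lambda>i j. \<pi> i \<bullet> (P *v \<pi> j))) A)
        \<partial>(\<Pi>\<^sub>M i\<in>{..<n}. F))"
    by (subst sum_ennreal[symmetric], rule nonneg)
      (intro sum.cong refl ennreal_alternative_density[OF F])
  also have "\<dots> = (\<integral>\<^sup>+\<pi>. (\<Sum>A\<in>adjacency_matrices n.
        ennreal (pmf (adjacency_pmf n (\<lambda>i j. \<pi> i \<bullet> (P *v \<pi> j))) A)) \<partial>(\<Pi>\<^sub>M i\<in>{..<n}. F))"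
    using F by (intro nn_integral_sum[symmetric] measurable_compose[OF _ measurable_ennreal]
        alternative_likelihood_measurable) (auto simp: distribution_on_simplex_def)
  also have "\<dots> = (\<integral>\<^sup>+\<pi>. 1 \<partial>(\<Pi>\<^sub>M i\<in>{..<n}. F))"
    by (simp add: sum_pmf_eq_1 finite_adjacency_matrices set_adjacency_pmf)
  finally show ?thesis by (simp add: emeasure_space_1)
qed

text \<open>
  Expanding the square leaves \<open>\<Sum> f1\<^sup>2 / f0 - 1\<close>, since both densities sum to \<open>1\<close> and \<open>f0\<close> is positive
  for \<open>0 < alpha0 < 1\<close>. The square of the mixture \<open>f1\<close> is an integral over two independent copies
  \<open>\<pi>\<close> and \<open>\<rho>\<close> of the membership matrix.
\<close>
lemma ennreal_chi_square_distance:
  fixes P :: "real ^ 'k ^ 'k"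
  assumes F: "distribution_on_simplex F"
    and a: "0 < alpha0 P (mean_membership F)" "alpha0 P (mean_membership F) < 1"
  shows "ennreal (1 + chi_square_distance n P F) =
    (\<integral>\<^sup>+\<pi>. \<integral>\<^sup>+\<rho>. ennreal (\<Sum>A\<in>adjacency_matrices n.
        pmf (adjacency_pmf n (\<lambda>i j. \<pi> i \<bullet> (P *v \<pi> j))) A *
        pmf (adjacency_pmf n (\<lambda>i j. \<rho> i \<bullet> (P *v \<rho> j))) A / null_density n P F A)
      \<partial>(\<Pi>\<^sub>M i\<in>{..<n}. F) \<partial>(\<Pi>\<^sub>M i\<in>{..<n}. F))"
proof -
  interpret prob_space "\<Pi>\<^sub>M i\<in>{..<n}. F"
    using F by (intro prob_space_PiM) (simp add: distribution_on_simplex_def)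
  let ?M = "\<Pi>\<^sub>M i\<in>{..<n}. F" and ?adj = "adjacency_matrices n"
  let ?f0 = "null_density n P F" and ?f1 = "alternative_density n P F"
  define L where "L \<pi> = pmf (adjacency_pmf n (\<lambda>i j. \<pi> i \<bullet> (P *v \<pi> j)))" for \<pi>
  have f1: "ennreal (?f1 A) = (\<integral>\<^sup>+\<pi>. ennreal (L \<pi> A) \<partial>?M)" if "A \<in> ?adj" for A
    unfolding L_def by (rule ennreal_alternative_density[OF F that])
  have L_measurable: "(\<lambda>\<pi>. L \<pi> A) \<in> borel_measurable ?M" if "A \<in> ?adj" for A
    unfolding L_def using F that
    by (intro alternative_likelihood_measurable) (auto simp: distribution_on_simplex_def)
  have f0: "?f0 A > 0" if "A \<in> ?adj" for A
    unfolding null_density_def pmf_adjacency_pmf[OF that]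
    using a by (intro prod_pos) (auto simp: pmf_bernoulli_clamp)
  have f1_nonneg: "?f1 A \<ge> 0" for A
    unfolding alternative_density_def by (intro integral_nonneg_AE) auto
  have "chi_square_distance n P F = (\<Sum>A\<in>?adj. ?f1 A * ?f1 A / ?f0 A - 2 * ?f1 A + ?f0 A)"
    unfolding chi_square_distance_def
    by (intro sum.cong refl) (use f0 in \<open>auto simp: field_simps power2_eq_square dest!: less_imp_neq[OF f0]\<close>)
  also have "\<dots> = (\<Sum>A\<in>?adj. ?f1 A * ?f1 A / ?f0 A) - 2 * (\<Sum>A\<in>?adj. ?f1 A) + (\<Sum>A\<in>?adj. ?f0 A)"
    by (simp add: sum.distrib sum_subtractf sum_distrib_left)
  also have "(\<Sum>A\<in>?adj. ?f0 A) = 1"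
    unfolding null_density_def
    by (intro sum_pmf_eq_1 finite_adjacency_matrices set_adjacency_pmf)
  finally have "1 + chi_square_distance n P F = (\<Sum>A\<in>?adj. ?f1 A * ?f1 A / ?f0 A)"
    by (simp add: sum_alternative_density[OF F])
  then have "ennreal (1 + chi_square_distance n P F) =
      (\<Sum>A\<in>?adj. ennreal (1 / ?f0 A) * ennreal (?f1 A) * ennreal (?f1 A))"
    using f1_nonneg f0
    by (simp add: sum_ennreal[symmetric] ennreal_mult[symmetric] less_imp_le del: sum_ennreal)
  also have "\<dots> = (\<Sum>A\<in>?adj. \<integral>\<^sup>+\<pi>. \<integral>\<^sup>+\<rho>. ennreal (L \<pi> A * L \<rho> A / ?f0 A) \<partial>?M \<partial>?M)"
  proof (intro sum.cong refl)
    fix A assume A: "A \<in> ?adj"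
    note [measurable] = L_measurable[OF A]
    have "(\<integral>\<^sup>+\<pi>. \<integral>\<^sup>+\<rho>. ennreal (L \<pi> A * L \<rho> A / ?f0 A) \<partial>?M \<partial>?M) =
        (\<integral>\<^sup>+\<pi>. \<integral>\<^sup>+\<rho>. ennreal (1 / ?f0 A) * ennreal (L \<pi> A) * ennreal (L \<rho> A) \<partial>?M \<partial>?M)"
      using f0[OF A] by (simp add: L_def flip: ennreal_mult)
    also have "\<dots> = ennreal (1 / ?f0 A) * (\<integral>\<^sup>+\<pi>. ennreal (L \<pi> A) \<partial>?M) * (\<integral>\<^sup>+\<rho>. ennreal (L \<rho> A) \<partial>?M)"
      by (simp add: nn_integral_cmult nn_integral_multc)
    finally show "ennreal (1 / ?f0 A) * ennreal (?f1 A) * ennreal (?f1 A) =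
        (\<integral>\<^sup>+\<pi>. \<integral>\<^sup>+\<rho>. ennreal (L \<pi> A * L \<rho> A / ?f0 A) \<partial>?M \<partial>?M)"
      by (simp add: f1[OF A])
  qed
  also have "\<dots> = (\<integral>\<^sup>+\<pi>. (\<Sum>A\<in>?adj. \<integral>\<^sup>+\<rho>. ennreal (L \<pi> A * L \<rho> A / ?f0 A) \<partial>?M) \<partial>?M)"
  proof (intro nn_integral_sum[symmetric])
    fix A assume A: "A \<in> ?adj"
    note [measurable] = L_measurable[OF A]
    show "(\<lambda>\<pi>. \<integral>\<^sup>+\<rho>. ennreal (L \<pi> A * L \<rho> A / ?f0 A) \<partial>?M) \<in> borel_measurable ?M"
      by measurable
  qed
  also have "\<dots> = (\<integral>\<^sup>+\<pi>. \<integral>\<^sup>+\<rho>. (\<Sum>A\<in>?adj. ennreal (L \<pi> A * L \<rho> A / ?f0 A)) \<partial>?M \<partial>?M)"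
    by (intro nn_integral_cong nn_integral_sum[symmetric]) (use L_measurable in measurable)
  also have "\<dots> = (\<integral>\<^sup>+\<pi>. \<integral>\<^sup>+\<rho>. ennreal (\<Sum>A\<in>?adj. L \<pi> A * L \<rho> A / ?f0 A) \<partial>?M \<partial>?M)"
    using f0 by (intro nn_integral_cong sum_ennreal) (auto simp: L_def intro!: divide_nonneg_pos)
  finally show ?thesis unfolding L_def .
qed


section \<open>Centring the quadratic form\<close>

lemma sum_symmetric_upper_pairs:
  fixes f :: "nat \<Rightarrow> nat \<Rightarrow> real"
  assumes sym: "\<And>i j. f i j = f j i"
  shows "(\<Sum>i<n. \<Sum>j<n. f i j) = 2 * (\<Sum>(i, j)\<in>upper_pairs n. f i j) + (\<Sum>i<n. f i i)"
proof (induction n)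
  case 0
  show ?case by (simp add: upper_pairs_def)
next
  case (Suc n)
  have "upper_pairs (Suc n) = upper_pairs n \<union> (\<lambda>i. (i, n)) ` {..<n}"
    by (auto simp: upper_pairs_def less_Suc_eq)
  moreover have "upper_pairs n \<inter> (\<lambda>i. (i, n)) ` {..<n} = {}"
    by (auto simp: upper_pairs_def)
  ultimately have "(\<Sum>(i, j)\<in>upper_pairs (Suc n). f i j) =
      (\<Sum>(i, j)\<in>upper_pairs n. f i j) + (\<Sum>i<n. f i n)"
    by (simp add: sum.union_disjoint finite_upper_pairs sum.reindex inj_on_def)
  moreover have "(\<Sum>j<n. f n j) = (\<Sum>i<n. f i n)"
    by (intro sum.cong sym) auto
  ultimately show ?case using Suc by (simp add: sum.distrib)
qed

definition outer_product :: "real ^ 'k \<Rightarrow> real ^ 'l \<Rightarrow> real ^ 'l ^ 'k" where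
  "outer_product x y = (\<chi> i j. x $ i * y $ j)"

lemma inner_outer_product:
  "outer_product x y \<bullet> outer_product a b = (x \<bullet> a) * (y \<bullet> b)"
  by (simp add: outer_product_def inner_vec_def sum_product mult_ac) (rule sum.swap)

lemma norm_outer_product: "norm (outer_product x y) = norm x * norm y"
  by (simp add: norm_eq_sqrt_inner inner_outer_product real_sqrt_mult)

lemma matrix_mult_outer_product:
  "M ** outer_product x y ** transpose N = outer_product (M *v x) (N *v y)"
  by (simp add: vec_eq_iff matrix_matrix_mult_def outer_product_def matrix_vector_mult_def
      transpose_def sum_product sum_distrib_left sum_distrib_right mult_ac)
    (intro allI sum.swap)

lemma norm_matrix_power2: "(norm A)\<^sup>2 = (\<Sum>i\<in>UNIV. (norm (A $ i))\<^sup>2)" for A :: "real ^ 'l ^ 'k"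
  by (simp add: norm_vec_def L2_set_def sum_nonneg)

lemma norm_matrix_power2_entries:
  fixes A :: "real ^ 'l ^ 'm"
  shows "(norm A)\<^sup>2 = (\<Sum>q\<in>UNIV. (A $ fst q $ snd q)\<^sup>2)"
proof -
  have "(norm A)\<^sup>2 = (\<Sum>i\<in>UNIV. \<Sum>j\<in>UNIV. (A $ i $ j)\<^sup>2)"
    by (simp add: norm_matrix_power2 norm_vec_def[where 'b = 'l] L2_set_def sum_nonneg)
  then show ?thesis
    by (simp add: sum.cartesian_product split_def)
qed

lemma norm_transpose: "norm (transpose A) = norm A" for A :: "real ^ 'l ^ 'k"
proof -
  have "(norm (transpose A))\<^sup>2 = (norm A)\<^sup>2"
    unfolding norm_matrix_power2
    unfolding norm_eq_sqrt_inner inner_vec_def transpose_def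
    by (simp add: sum_nonneg) (rule sum.swap)
  then show ?thesis by simp
qed

text \<open>
  The rows of \<open>B ** transpose M\<close> are the images under \<open>M\<close> of the rows of \<open>B\<close>, and the squared
  Frobenius norm, which is the norm of the type, is the sum of the squared norms of the rows.
\<close>
lemma norm_mult_transpose_le:
  fixes M :: "real ^ 'l ^ 'm" and B :: "real ^ 'l ^ 'k"
  shows "norm (B ** transpose M) \<le> onorm ((*v) M) * norm B"
proof -
  have row: "(B ** transpose M) $ i = M *v (B $ i)" for i
    by (simp add: vec_eq_iff matrix_matrix_mult_def matrix_vector_mult_def transpose_def mult_ac)
  have "(norm (B ** transpose M))\<^sup>2 \<le> (\<Sum>i\<in>UNIV. (onorm ((*v) M) * norm (B $ i))\<^sup>2)"
    unfolding norm_matrix_power2 row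
    by (intro sum_mono power_mono onorm matrix_vector_mul_bounded_linear norm_ge_zero)
  also have "\<dots> = (onorm ((*v) M) * norm B)\<^sup>2"
    unfolding power_mult_distrib norm_matrix_power2 by (simp add: sum_distrib_left)
  finally show ?thesis
    by (rule power2_le_imp_le) (simp add: onorm_pos_le)
qed

lemma norm_mult_mult_transpose_le:
  fixes M :: "real ^ 'k ^ 'k"
  shows "norm (M ** B ** transpose M) \<le> (onorm ((*v) M))\<^sup>2 * norm B"
proof -
  have "norm (M ** B) = norm (transpose B ** transpose M)"
    by (metis matrix_transpose_mul norm_transpose)
  also have "\<dots> \<le> onorm ((*v) M) * norm B"
    using norm_mult_transpose_le[of "transpose B" M] by (simp add: norm_transpose)
  finally have "norm (M ** B) \<le> onorm ((*v) M) * norm B" .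
  then have "onorm ((*v) M) * norm (M ** B) \<le> onorm ((*v) M) * (onorm ((*v) M) * norm B)"
    by (intro mult_left_mono) (simp_all add: onorm_pos_le)
  with norm_mult_transpose_le[of "M ** B" M] show ?thesis
    by (simp add: power2_eq_square mult_ac)
qed

text \<open>
  The product of the two bilinear forms is the single form \<open>A \<bullet> M B M'\<close> on matrices, evaluated at the
  rank-one matrices \<open>x i (y i)'\<close>. The double sum is thus a quadratic form in \<open>\<Sum>i. x i (y i)'\<close>, which
  is expanded around \<open>n h h'\<close>. The constant term of the expansion is \<open>n\<^sup>2 (h \<bullet> M h)\<^sup>2 = 0\<close>, and the
  linear term involves only \<open>M (h h') M' = (M h) (M h)'\<close>. The last summand of the bound pays for the
  diagonal terms \<open>i = j\<close>.
\<close>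
lemma sum_upper_pairs_bilinear_product_le:
  fixes M :: "real ^ 'k ^ 'k" and x y :: "nat \<Rightarrow> real ^ 'k"
  assumes sym: "transpose M = M" and h: "h \<bullet> (M *v h) = 0"
    and x: "\<And>i. i < n \<Longrightarrow> norm (x i) \<le> 1" and y: "\<And>i. i < n \<Longrightarrow> norm (y i) \<le> 1"
  defines "R \<equiv> \<Sum>i<n. (outer_product (x i) (y i) - outer_product h h)"
    and "m \<equiv> onorm ((*v) M)"
  shows "(\<Sum>(i, j)\<in>upper_pairs n. (x i \<bullet> (M *v x j)) * (y i \<bullet> (M *v y j)))
          \<le> real n * (norm (M *v h))\<^sup>2 * norm R + m\<^sup>2 / 2 * (norm R)\<^sup>2 + real n * m\<^sup>2 / 2"
proof -
  have m: "m \<ge> 0"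
    by (simp add: m_def onorm_pos_le)
  have swap: "a \<bullet> (M *v b) = b \<bullet> (M *v a)" for a b
    by (metis dot_lmul_matrix inner_commute sym transpose_matrix_vector)
  define L where "L B = M ** B ** transpose M" for B
  have L: "linear L"
    by (rule linearI)
      (simp_all add: L_def vec_eq_iff matrix_matrix_mult_def algebra_simps sum.distrib
        sum_distrib_left)
  have L_outer: "outer_product a b \<bullet> L (outer_product c d) = (a \<bullet> (M *v c)) * (b \<bullet> (M *v d))"
    for a b c d
    by (simp add: L_def matrix_mult_outer_product inner_outer_product)
  define H where "H = outer_product h h"
  define T where "T i = outer_product (x i) (y i)" for i
  have HH: "H \<bullet> L H = 0" by (simp add: H_def L_outer h)
  have R: "R = (\<Sum>i<n. T i) - real n *\<^sub>R H"
    by (simp add: R_def T_def H_def sum_subtractf scaleR_conv_of_real)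
  have HT: "H \<bullet> L (T i) = T i \<bullet> L H" for i
    by (simp add: H_def T_def L_outer swap)
  \<comment> \<open>The two mixed terms of the expansion agree.\<close>
  have HR: "H \<bullet> L R = R \<bullet> L H"
    by (simp add: R linear_diff[OF L] linear_sum[OF L] linear_scale[OF L] inner_diff_right
        inner_diff_left inner_sum_right inner_sum_left HT)
  have "(\<Sum>i<n. \<Sum>j<n. (x i \<bullet> (M *v x j)) * (y i \<bullet> (M *v y j))) = (\<Sum>i<n. T i) \<bullet> L (\<Sum>i<n. T i)"
    by (simp add: T_def linear_sum[OF L] inner_sum_left inner_sum_right L_outer)
      (rule sum.swap)
  also have "(\<Sum>i<n. T i) = R + real n *\<^sub>R H" by (simp add: R)
  also have "(R + real n *\<^sub>R H) \<bullet> L (R + real n *\<^sub>R H) = 2 * real n * (R \<bullet> L H) + R \<bullet> L R"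
    by (simp add: linear_add[OF L] linear_scale[OF L] inner_add_left inner_add_right HH HR)
  also have "R \<bullet> L H \<le> norm R * norm (L H)"
    by (rule norm_cauchy_schwarz)
  also have "norm (L H) = (norm (M *v h))\<^sup>2"
    by (simp add: L_def H_def matrix_mult_outer_product norm_outer_product power2_eq_square)
  also have "R \<bullet> L R \<le> norm R * norm (L R)"
    by (rule norm_cauchy_schwarz)
  also have "norm (L R) \<le> m\<^sup>2 * norm R"
    unfolding L_def m_def by (rule norm_mult_mult_transpose_le)
  finally have full: "(\<Sum>i<n. \<Sum>j<n. (x i \<bullet> (M *v x j)) * (y i \<bullet> (M *v y j)))
      \<le> 2 * real n * (norm R * (norm (M *v h))\<^sup>2) + norm R * (m\<^sup>2 * norm R)"
    by (simp add: mult_left_mono)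
  have quad: "\<bar>a \<bullet> (M *v a)\<bar> \<le> m" if "norm a \<le> 1" for a
  proof -
    have "\<bar>a \<bullet> (M *v a)\<bar> \<le> norm a * norm (M *v a)"
      by (rule Cauchy_Schwarz_ineq2)
    also have "norm (M *v a) \<le> m * norm a"
      unfolding m_def by (rule onorm[OF matrix_vector_mul_bounded_linear])
    also have "norm a * (m * norm a) \<le> 1 * (m * 1)"
      using that m by (intro mult_mono) auto
    finally show ?thesis by (simp add: mult_left_mono)
  qed
  have "(\<Sum>i<n. (x i \<bullet> (M *v x i)) * (y i \<bullet> (M *v y i))) \<ge> (\<Sum>i<n. - m\<^sup>2)"
  proof (rule sum_mono)
    fix i assume "i \<in> {..<n}"
    then have "\<bar>x i \<bullet> (M *v x i)\<bar> * \<bar>y i \<bullet> (M *v y i)\<bar> \<le> m * m"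
      using m by (intro mult_mono quad x y) auto
    then show "- m\<^sup>2 \<le> (x i \<bullet> (M *v x i)) * (y i \<bullet> (M *v y i))"
      by (simp add: power2_eq_square flip: abs_mult)
  qed
  then have diag: "(\<Sum>i<n. (x i \<bullet> (M *v x i)) * (y i \<bullet> (M *v y i))) \<ge> - (real n * m\<^sup>2)"
    by simp
  have "(\<Sum>i<n. \<Sum>j<n. (x i \<bullet> (M *v x j)) * (y i \<bullet> (M *v y j))) =
      2 * (\<Sum>(i, j)\<in>upper_pairs n. (x i \<bullet> (M *v x j)) * (y i \<bullet> (M *v y j)))
      + (\<Sum>i<n. (x i \<bullet> (M *v x i)) * (y i \<bullet> (M *v y i)))"
    by (rule sum_symmetric_upper_pairs) (simp add: swap)
  with full diag show ?thesis
    by (simp add: power2_eq_square algebra_simps)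
qed


section \<open>Exponential moments of squared sums\<close>

text \<open>
  Hoeffding's lemma on the interval \<open>[-1, 1]\<close>, for exponents of either sign.
\<close>
lemma (in prob_space) nn_integral_exp_mean_zero_le:
  fixes X :: "'a \<Rightarrow> real"
  assumes [measurable]: "X \<in> borel_measurable M"
    and bounded: "AE x in M. \<bar>X x\<bar> \<le> 1" and mean: "expectation X = 0"
  shows "(\<integral>\<^sup>+x. ennreal (exp (l * X x)) \<partial>M) \<le> ennreal (exp (l\<^sup>2 / 2))"
proof -
  have *: "(\<integral>\<^sup>+x. ennreal (exp (l * X x)) \<partial>M) \<le> ennreal (exp (l\<^sup>2 / 2))"
    if [measurable]: "X \<in> borel_measurable M"
      and bounded: "AE x in M. \<bar>X x\<bar> \<le> 1" and mean: "expectation X = 0" and "l > 0"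
    for X :: "'a \<Rightarrow> real" and l
  proof -
    interpret interval_bounded_random_variable M X "-1" 1
      using bounded by unfold_locales (auto elim!: eventually_mono)
    show ?thesis
      using Hoeffdings_lemma_nn_integral_0[OF \<open>l > 0\<close> mean] by (simp add: power2_eq_square)
  qed
  consider "l > 0" | "l = 0" | "l < 0" by linarith
  then show ?thesis
  proof cases
    case 1
    then show ?thesis using *[of X l] assms by simp
  next
    case 2
    then show ?thesis by (simp add: emeasure_space_1)
  next
    case 3
    then show ?thesis using *[of "\<lambda>x. - X x" "- l"] assms by simp
  qed
qed

text \<open>
  Integrating out the last summand of a sum \<open>r + X\<close>. In \<open>(r + X)\<^sup>2 = r\<^sup>2 + 2 r X + X\<^sup>2\<close> the last term is
  at most \<open>1\<close>, and Hoeffding's lemma turns the cross term into \<open>2 t\<^sup>2 r\<^sup>2\<close>. The result is again the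
  exponential of a square, with a slightly larger rate \<open>t + 2 t\<^sup>2\<close>.
\<close>
lemma (in prob_space) nn_integral_exp_shifted_square_le:
  fixes X :: "'a \<Rightarrow> real"
  assumes [measurable]: "X \<in> borel_measurable M"
    and bounded: "AE x in M. \<bar>X x\<bar> \<le> 1" and mean: "expectation X = 0" and "t \<ge> 0"
  shows "(\<integral>\<^sup>+x. ennreal (exp (t * (r + X x)\<^sup>2)) \<partial>M) \<le> ennreal (exp (t + (t + 2 * t\<^sup>2) * r\<^sup>2))"
proof -
  have "(\<integral>\<^sup>+x. ennreal (exp (t * (r + X x)\<^sup>2)) \<partial>M) \<le>
      (\<integral>\<^sup>+x. ennreal (exp (t + t * r\<^sup>2)) * ennreal (exp ((2 * t * r) * X x)) \<partial>M)"
    using bounded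
  proof (intro nn_integral_mono_AE, elim eventually_mono)
    fix x assume "\<bar>X x\<bar> \<le> 1"
    then have "t * (X x)\<^sup>2 \<le> t * 1"
      using \<open>t \<ge> 0\<close> by (intro mult_left_mono) (auto simp: abs_square_le_1)
    then have "t * (r + X x)\<^sup>2 \<le> (t + t * r\<^sup>2) + (2 * t * r) * X x"
      by (simp add: power2_sum algebra_simps)
    then show "ennreal (exp (t * (r + X x)\<^sup>2)) \<le>
        ennreal (exp (t + t * r\<^sup>2)) * ennreal (exp ((2 * t * r) * X x))"
      by (simp flip: ennreal_mult exp_add)
  qed
  also have "\<dots> = ennreal (exp (t + t * r\<^sup>2)) * (\<integral>\<^sup>+x. ennreal (exp ((2 * t * r) * X x)) \<partial>M)"
    by (rule nn_integral_cmult) measurable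
  also have "\<dots> \<le> ennreal (exp (t + t * r\<^sup>2)) * ennreal (exp ((2 * t * r)\<^sup>2 / 2))"
    by (intro mult_left_mono nn_integral_exp_mean_zero_le assms) auto
  also have "\<dots> = ennreal (exp (t + (t + 2 * t\<^sup>2) * r\<^sup>2))"
    by (simp add: power_mult_distrib algebra_simps flip: ennreal_mult exp_add)
  finally show ?thesis .
qed

text \<open>
  The map sending \<open>t\<close> to \<open>t / (1 - 2 t)\<close> lowers the reciprocal of \<open>t\<close> by exactly \<open>2\<close> and dominates
  \<open>t + 2 t\<^sup>2\<close>. Its \<open>n\<close>-th iterate is \<open>t / (1 - 2 n t)\<close>, so one step at rate \<open>t\<close> followed by \<open>n\<close> steps
  stays below \<open>n + 1\<close> iterates.
\<close>
lemma iterated_rate_le: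
  fixes t :: real
  assumes "t \<ge> 0" "2 * real (Suc n) * t < 1"
  shows "2 * real n * (t + 2 * t\<^sup>2) < 1"
    and "(t + 2 * t\<^sup>2) / (1 - 2 * real n * (t + 2 * t\<^sup>2)) \<le> t / (1 - 2 * real (Suc n) * t)"
proof -
  let ?s = "t + 2 * t\<^sup>2"
  have a: "?s * (1 - 2 * t) \<le> t" using assms by (simp add: algebra_simps power2_eq_square)
  have n: "real n \<ge> 0" by simp
  have t: "2 * t + 2 * real n * t < 1" using assms(2) by (simp add: algebra_simps)
  have t1: "2 * t < 1" using t n assms(1) by (smt (verit) mult_nonneg_nonneg)
  have "2 * real n * ?s * (1 - 2 * t) \<le> 2 * real n * t" using a n by (simp add: mult_left_mono mult.assoc)
  also have "\<dots> < 1 - 2 * t" using t by simp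
  finally show b: "2 * real n * ?s < 1" using t1 by (simp add: mult_less_cancel_right2)
  have "?s * (1 - 2 * real (Suc n) * t) \<le> t * (1 - 2 * real n * ?s)" using a by (simp add: algebra_simps)
  then show "?s / (1 - 2 * real n * ?s) \<le> t / (1 - 2 * real (Suc n) * t)"
    using b assms(2) by (simp add: divide_simps)
qed

text \<open>
  Subgaussian behaviour of sums of independent centred variables, expressed through the exponential
  moment of the square. Removing the summands one by one raises the rate from \<open>t\<close> to at most
  \<open>t / (1 - 2 n t)\<close>, and each removal costs a factor \<open>exp\<close> of the current rate. The summands depend on
  two independent families, whose joint law is kept as an iterated integral over two product
  measures.
\<close>
lemma nn_integral_exp_square_sum_le:
  fixes g :: "'a \<Rightarrow> 'b \<Rightarrow> real"
  assumes "prob_space M" "prob_space N"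
    and [measurable]: "case_prod g \<in> borel_measurable (M \<Otimes>\<^sub>M N)"
    and bounded: "AE z in M \<Otimes>\<^sub>M N. \<bar>case_prod g z\<bar> \<le> 1"
    and mean: "(\<integral>z. case_prod g z \<partial>(M \<Otimes>\<^sub>M N)) = 0"
    and "t \<ge> 0" "2 * real n * t < 1"
  shows "(\<integral>\<^sup>+x. \<integral>\<^sup>+y. ennreal (exp (t * (\<Sum>i<n. g (x i) (y i))\<^sup>2)) \<partial>(\<Pi>\<^sub>M i\<in>{..<n}. N)
            \<partial>(\<Pi>\<^sub>M i\<in>{..<n}. M))
          \<le> ennreal (exp (real n * t / (1 - 2 * real n * t)))"
  using \<open>t \<ge> 0\<close> \<open>2 * real n * t < 1\<close>
proof (induction n arbitrary: t)
  case 0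
  show ?case by (simp add: PiM_empty nn_integral_count_space_finite)
next
  case (Suc n)
  interpret M: prob_space M by fact
  interpret N: prob_space N by fact
  interpret MN: pair_prob_space M N ..
  interpret PM: product_sigma_finite "\<lambda>_::nat. M" by unfold_locales
  interpret PN: product_sigma_finite "\<lambda>_::nat. N" by unfold_locales
  let ?PM = "\<lambda>n. \<Pi>\<^sub>M i\<in>{..<n}. M" and ?PN = "\<lambda>n. \<Pi>\<^sub>M i\<in>{..<n}. N"
  let ?S = "\<lambda>x y. \<Sum>i<n. g (x i) (y i)"
  interpret PNn: prob_space "?PN n" by (intro prob_space_PiM \<open>prob_space N\<close>)
  interpret sw: pair_sigma_finite M "?PN n" by unfold_locales
  interpret PNs: prob_space "?PN (Suc n)" by (intro prob_space_PiM \<open>prob_space N\<close>)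
  let ?t = "t + 2 * t\<^sup>2"
  have upd: "(\<Sum>i<Suc n. g ((x(n := a)) i) (y i)) = ?S x y + g a (y n)" for x a y
    by simp
  have upd': "?S x (y(n := b)) + g a ((y(n := b)) n) = ?S x y + g a b" for x a y b
    by simp
  have insert_n: "{..<Suc n} = insert n {..<n}" by auto
  have S_measurable: "?S x \<in> borel_measurable (?PN n)" if x: "x \<in> space (?PM n)" for x
  proof -
    have "(\<lambda>y. g (x i) (y i)) \<in> borel_measurable (?PN n)" if "i \<in> {..<n}" for i
    proof -
      have "x i \<in> space M" using x that by (auto simp: space_PiM)
      then show ?thesis using that by measurable
    qed
    then show ?thesis by measurable
  qed
  have [measurable]: "(\<lambda>x. \<integral>\<^sup>+y. ennreal (exp (t * (\<Sum>i<Suc n. g (x i) (y i))\<^sup>2)) \<partial>?PN (Suc n))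
      \<in> borel_measurable (?PM (Suc n))"
    by measurable
  have "(\<integral>\<^sup>+x. \<integral>\<^sup>+y. ennreal (exp (t * (\<Sum>i<Suc n. g (x i) (y i))\<^sup>2)) \<partial>?PN (Suc n) \<partial>?PM (Suc n))
      = (\<integral>\<^sup>+x. \<integral>\<^sup>+a. \<integral>\<^sup>+y. ennreal (exp (t * (\<Sum>i<Suc n. g ((x(n := a)) i) (y i))\<^sup>2))
            \<partial>?PN (Suc n) \<partial>M \<partial>?PM n)"
    using PM.product_nn_integral_insert[of "{..<n}" n, folded insert_n] by simp
  also have "\<dots> = (\<integral>\<^sup>+x. \<integral>\<^sup>+a. \<integral>\<^sup>+y. \<integral>\<^sup>+b. ennreal (exp (t * (?S x y + g a b)\<^sup>2))
            \<partial>N \<partial>?PN n \<partial>M \<partial>?PM n)"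
  proof (intro nn_integral_cong)
    fix x a assume x: "x \<in> space (?PM n)" and a: "a \<in> space M"
    have "(\<lambda>y. g (x i) (y i)) \<in> borel_measurable (?PN (Suc n))" if "i < n" for i
    proof -
      have "x i \<in> space M" "i \<in> {..<Suc n}" using x that by (auto simp: space_PiM)
      then show ?thesis by measurable
    qed
    moreover have "(\<lambda>y. g a (y n)) \<in> borel_measurable (?PN (Suc n))"
      using a by measurable
    ultimately have "(\<lambda>y. exp (t * (?S x y + g a (y n))\<^sup>2)) \<in> borel_measurable (?PN (Suc n))"
      by measurable
    then show "(\<integral>\<^sup>+y. ennreal (exp (t * (\<Sum>i<Suc n. g ((x(n := a)) i) (y i))\<^sup>2)) \<partial>?PN (Suc n))
        = (\<integral>\<^sup>+y. \<integral>\<^sup>+b. ennreal (exp (t * (?S x y + g a b)\<^sup>2)) \<partial>N \<partial>?PN n)"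
      unfolding upd
      by (subst PN.product_nn_integral_insert[of "{..<n}" n, folded insert_n]) (simp_all add: upd')
  qed
  \<comment> \<open>Exchanging the middle integrals brings the last pair of coordinates together.\<close>
  also have "\<dots> = (\<integral>\<^sup>+x. \<integral>\<^sup>+y. \<integral>\<^sup>+a. \<integral>\<^sup>+b. ennreal (exp (t * (?S x y + g a b)\<^sup>2))
            \<partial>N \<partial>M \<partial>?PN n \<partial>?PM n)"
  proof (intro nn_integral_cong sw.Fubini'[symmetric])
    fix x assume x: "x \<in> space (?PM n)"
    note S_measurable[OF x, measurable]
    show "(\<lambda>(a, y). \<integral>\<^sup>+b. ennreal (exp (t * (?S x y + g a b)\<^sup>2)) \<partial>N)
        \<in> borel_measurable (M \<Otimes>\<^sub>M ?PN n)"
      by measurable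
  qed
  also have "\<dots> = (\<integral>\<^sup>+x. \<integral>\<^sup>+y. \<integral>\<^sup>+z. ennreal (exp (t * (?S x y + case_prod g z)\<^sup>2))
            \<partial>(M \<Otimes>\<^sub>M N) \<partial>?PN n \<partial>?PM n)"
    by (intro nn_integral_cong, subst N.nn_integral_fst[symmetric]) simp_all
  also have "\<dots> \<le> (\<integral>\<^sup>+x. \<integral>\<^sup>+y. ennreal (exp (t + ?t * (?S x y)\<^sup>2)) \<partial>?PN n \<partial>?PM n)"
    using bounded mean Suc.prems
    by (intro nn_integral_mono MN.nn_integral_exp_shifted_square_le) auto
  also have "\<dots> =
      (\<integral>\<^sup>+x. ennreal (exp t) * (\<integral>\<^sup>+y. ennreal (exp (?t * (?S x y)\<^sup>2)) \<partial>?PN n) \<partial>?PM n)"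
  proof (intro nn_integral_cong)
    fix x assume x: "x \<in> space (?PM n)"
    note S_measurable[OF x, measurable]
    show "(\<integral>\<^sup>+y. ennreal (exp (t + ?t * (?S x y)\<^sup>2)) \<partial>?PN n) =
        ennreal (exp t) * (\<integral>\<^sup>+y. ennreal (exp (?t * (?S x y)\<^sup>2)) \<partial>?PN n)"
      by (subst nn_integral_cmult[symmetric]) (simp_all add: exp_add ennreal_mult)
  qed
  also have "\<dots> = ennreal (exp t) *
      (\<integral>\<^sup>+x. \<integral>\<^sup>+y. ennreal (exp (?t * (?S x y)\<^sup>2)) \<partial>?PN n \<partial>?PM n)"
    by (rule nn_integral_cmult) measurable
  also have "\<dots> \<le> ennreal (exp t) * ennreal (exp (real n * ?t / (1 - 2 * real n * ?t)))"
    using Suc.prems iterated_rate_le(1)[of t n] by (intro mult_left_mono Suc.IH) auto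
  also have "\<dots> \<le> ennreal (exp (real (Suc n) * t / (1 - 2 * real (Suc n) * t)))"
  proof -
    have "real n * (?t / (1 - 2 * real n * ?t)) \<le> real n * (t / (1 - 2 * real (Suc n) * t))"
      using iterated_rate_le(2)[of t n] Suc.prems by (intro mult_left_mono) auto
    moreover have "t / 1 \<le> t / (1 - 2 * real (Suc n) * t)"
      using Suc.prems by (intro divide_left_mono) auto
    ultimately have "t + real n * ?t / (1 - 2 * real n * ?t) \<le>
        real (Suc n) * t / (1 - 2 * real (Suc n) * t)"
      by (simp add: algebra_simps add_divide_distrib)
    then show ?thesis
      by (simp flip: ennreal_mult exp_add)
  qed
  finally show ?case .
qed

text \<open>
  Jensen's inequality. It decouples dependent summands at the price of multiplying each of them by
  their number.
\<close>
lemma exp_sum_le_average: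
  fixes a :: "'b \<Rightarrow> real"
  assumes "finite Q" "Q \<noteq> {}"
  shows "exp (\<Sum>q\<in>Q. a q) \<le> (\<Sum>q\<in>Q. exp (real (card Q) * a q) / real (card Q))"
proof -
  have "exp (\<Sum>q\<in>Q. (1 / real (card Q)) *\<^sub>R (real (card Q) * a q))
      \<le> (\<Sum>q\<in>Q. 1 / real (card Q) * exp (real (card Q) * a q))"
    using assms by (intro convex_on_sum[OF _ _ exp_convex]) auto
  then show ?thesis using assms by simp
qed


section \<open>Membership vectors\<close>

lemma norm_prob_simplex_le: "x \<in> prob_simplex \<Longrightarrow> norm x \<le> 1"
  using norm_le_l1_cart[of x] by (auto simp: prob_simplex_def)

lemma component_prob_simplex:
  assumes "x \<in> prob_simplex"
  shows "0 \<le> x $ k" "x $ k \<le> 1"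
  using assms member_le_sum[of k UNIV "\<lambda>k. x $ k"] by (auto simp: prob_simplex_def)

lemma vec_nth_measurable [measurable]: "(\<lambda>x :: real ^ 'k. x $ k) \<in> borel_measurable borel"
  by (intro borel_measurable_continuous_onI continuous_intros)

text \<open>
  The form is an average of the entries of \<open>P\<close> with weights \<open>x $ i * y $ j\<close>.
\<close>
lemma quadratic_form_prob_simplex:
  fixes P :: "real ^ 'k ^ 'k"
  assumes P: "\<And>i j. P $ i $ j \<in> {0..1}" and x: "x \<in> prob_simplex" and y: "y \<in> prob_simplex"
  shows "x \<bullet> (P *v y) \<in> {0..1}"
proof -
  note xy = component_prob_simplex[OF x] component_prob_simplex[OF y]
  have "(P *v y) $ k \<in> {0..1}" for k
  proof -
    have "(\<Sum>l\<in>UNIV. P $ k $ l * y $ l) \<le> (\<Sum>l\<in>UNIV. 1 * y $ l)"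
      using P xy by (intro sum_mono mult_right_mono) auto
    then have "(P *v y) $ k \<le> 1" using y by (simp add: matrix_vector_mult_def prob_simplex_def)
    moreover have "(P *v y) $ k \<ge> 0"
      using P xy by (auto simp: matrix_vector_mult_def intro!: sum_nonneg mult_nonneg_nonneg)
    ultimately show ?thesis by simp
  qed
  then have "0 \<le> (\<Sum>k\<in>UNIV. x $ k * (P *v y) $ k)" "(\<Sum>k\<in>UNIV. x $ k * (P *v y) $ k) \<le> (\<Sum>k\<in>UNIV. x $ k * 1)"
    using xy by (auto intro!: sum_nonneg sum_mono mult_left_mono simp del: mult_1_right)
  then show ?thesis using x by (simp add: inner_vec_def prob_simplex_def)
qed

context
  fixes F :: "(real ^ 'k) measure"
  assumes F: "distribution_on_simplex F"
begin

interpretation prob_space F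
  using F by (simp add: distribution_on_simplex_def)

lemma sets_F [measurable_cong]: "sets F = sets borel"
  using F by (simp add: distribution_on_simplex_def)

lemma AE_prob_simplex: "AE x in F. x \<in> prob_simplex"
  using F by (simp add: distribution_on_simplex_def)

lemma integrable_component: "integrable F (\<lambda>x. x $ k)"
  using AE_prob_simplex
  by (intro integrable_const_bound[where B = 1])
    (auto elim!: eventually_mono simp: component_prob_simplex)

lemma mean_membership_component: "mean_membership F $ k = (\<integral>x. x $ k \<partial>F)"
proof -
  have "integrable F (\<lambda>x. x)"
    using AE_prob_simplex
    by (intro integrable_const_bound[where B = 1])
      (auto elim!: eventually_mono simp: norm_prob_simplex_le)
  then show ?thesis
    unfolding mean_membership_def by (rule integral_bounded_linear[OF bounded_linear_vec_nth, symmetric])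
qed

lemma mean_membership_prob_simplex: "mean_membership F \<in> prob_simplex"
proof -
  have "0 \<le> (\<integral>x. x $ k \<partial>F)" for k
    using AE_prob_simplex
    by (intro integral_nonneg_AE) (auto elim!: eventually_mono simp: component_prob_simplex)
  moreover have "(\<Sum>k\<in>UNIV. \<integral>x. x $ k \<partial>F) = 1"
  proof -
    have "(\<Sum>k\<in>UNIV. \<integral>x. x $ k \<partial>F) = (\<integral>x. (\<Sum>k\<in>UNIV. x $ k) \<partial>F)"
      by (simp add: integrable_component)
    also have "\<dots> = (\<integral>x. 1 \<partial>F)"
      using AE_prob_simplex
      by (intro integral_cong_AE) (auto elim!: eventually_mono simp: prob_simplex_def)
    finally show ?thesis by (simp add: prob_space)
  qed
  ultimately show ?thesis
    by (simp add: prob_simplex_def mean_membership_component)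
qed

lemma AE_membership_prob_simplex:
  fixes n :: nat
  shows "AE \<pi> in (\<Pi>\<^sub>M i\<in>{..<n}. F). \<forall>i\<in>{..<n}. \<pi> i \<in> prob_simplex"
  using AE_prob_simplex
  by (intro eventually_ball_finite ballI AE_PiM_component prob_space_axioms) auto

lemma nn_integral_exp_entry_square_le:
  fixes k l :: 'k
  assumes "t \<ge> 0" "2 * real n * t < 1"
  shows "(\<integral>\<^sup>+\<pi>. \<integral>\<^sup>+\<rho>. ennreal (exp (t * (\<Sum>i<n. \<pi> i $ k * \<rho> i $ l
            - mean_membership F $ k * mean_membership F $ l)\<^sup>2)) \<partial>(\<Pi>\<^sub>M i\<in>{..<n}. F) \<partial>(\<Pi>\<^sub>M i\<in>{..<n}. F))
          \<le> ennreal (exp (real n * t / (1 - 2 * real n * t)))"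
proof (rule nn_integral_exp_square_sum_le[where g = "\<lambda>x y. x $ k * y $ l
            - mean_membership F $ k * mean_membership F $ l"])
  let ?h = "mean_membership F"
  interpret FF: pair_prob_space F F ..
  show "(\<lambda>(x, y). x $ k * y $ l - ?h $ k * ?h $ l) \<in> borel_measurable (F \<Otimes>\<^sub>M F)"
    by measurable
  show bounded: "AE z in F \<Otimes>\<^sub>M F. \<bar>case z of (x, y) \<Rightarrow> x $ k * y $ l - ?h $ k * ?h $ l\<bar> \<le> 1"
  proof (rule FF.AE_pair_measure)
    show "AE x in F. AE y in F. \<bar>case (x, y) of (x, y) \<Rightarrow> x $ k * y $ l - ?h $ k * ?h $ l\<bar> \<le> 1"
      using AE_prob_simplex
    proof eventually_elim
      fix x :: "real ^ 'k" assume x: "x \<in> prob_simplex"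
      show "AE y in F. \<bar>case (x, y) of (x, y) \<Rightarrow> x $ k * y $ l - ?h $ k * ?h $ l\<bar> \<le> 1"
        using AE_prob_simplex
      proof eventually_elim
        fix y :: "real ^ 'k" assume y: "y \<in> prob_simplex"
        have *: "0 \<le> u $ k * v $ l \<and> u $ k * v $ l \<le> 1"
          if "u \<in> prob_simplex" "v \<in> prob_simplex" for u v :: "real ^ 'k"
          using component_prob_simplex[OF that(1), of k] component_prob_simplex[OF that(2), of l]
          by (simp add: mult_le_one)
        show "\<bar>case (x, y) of (x, y) \<Rightarrow> x $ k * y $ l - ?h $ k * ?h $ l\<bar> \<le> 1"
          using *[OF x y] *[OF mean_membership_prob_simplex mean_membership_prob_simplex]
          unfolding prod.case by linarith
      qed
    qed
  qed measurable
  have int: "integrable (F \<Otimes>\<^sub>M F) (\<lambda>(x, y). x $ k * y $ l - ?h $ k * ?h $ l)"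
    using bounded by (intro FF.integrable_const_bound[where B = 1]) auto
  have "(\<integral>z. (case z of (x, y) \<Rightarrow> x $ k * y $ l - ?h $ k * ?h $ l) \<partial>(F \<Otimes>\<^sub>M F)) =
      (\<integral>x. \<integral>y. x $ k * y $ l - ?h $ k * ?h $ l \<partial>F \<partial>F)"
    using FF.integral_fst'[OF int] by simp
  also have "\<dots> = (\<integral>x. x $ k * ?h $ l - ?h $ k * ?h $ l \<partial>F)"
    by (simp add: integrable_component mean_membership_component prob_space)
  also have "\<dots> = 0"
    by (simp add: integrable_component mean_membership_component prob_space)
  finally show "(\<integral>z. (case z of (x, y) \<Rightarrow> x $ k * y $ l - ?h $ k * ?h $ l) \<partial>(F \<Otimes>\<^sub>M F)) = 0" .
qed (use assms prob_space_axioms in auto)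

text \<open>
  The squared Frobenius norm is a sum of \<open>N\<close> squared entries, which are dependent. Jensen's inequality
  bounds the exponential of the sum by the average of the exponentials at rate \<open>N * \<theta>\<close>. The factor
  \<open>C\<close> carries along deterministic contributions to the exponent.
\<close>
lemma nn_integral_exp_norm_square_le:
  fixes n :: nat and \<theta> C :: real
  defines "N \<equiv> (real CARD('k))\<^sup>2" and "H \<equiv> outer_product (mean_membership F) (mean_membership F)"
  assumes C: "C \<ge> 0" and \<theta>: "\<theta> \<ge> 0" "2 * (N * (real n * \<theta>)) < 1"
  shows "(\<integral>\<^sup>+\<pi>. \<integral>\<^sup>+\<rho>. ennreal (C * exp (\<theta> * (norm (\<Sum>i<n. outer_product (\<pi> i) (\<rho> i) - H))\<^sup>2))
            \<partial>(\<Pi>\<^sub>M i\<in>{..<n}. F) \<partial>(\<Pi>\<^sub>M i\<in>{..<n}. F))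
          \<le> ennreal (C * exp (N * (real n * \<theta>) / (1 - 2 * (N * (real n * \<theta>)))))"
proof -
  let ?h = "mean_membership F" and ?M = "\<Pi>\<^sub>M i\<in>{..<n}. F"
  let ?B = "ennreal (exp (N * (real n * \<theta>) / (1 - 2 * (N * (real n * \<theta>)))))"
  interpret M: prob_space ?M
    by (intro prob_space_PiM prob_space_axioms)
  define Q :: "('k \<times> 'k) set" where "Q = UNIV"
  have Q: "finite Q" "Q \<noteq> {}" "real (card Q) = N"
    by (simp_all add: Q_def N_def power2_eq_square card_cartesian_product flip: UNIV_Times_UNIV)
  have N: "N > 0" by (simp add: N_def)
  define R where "R \<pi> \<rho> q = (\<Sum>i<n. \<pi> i $ fst q * \<rho> i $ snd q - ?h $ fst q * ?h $ snd q)"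
    for \<pi> \<rho> :: "nat \<Rightarrow> real ^ 'k" and q :: "'k \<times> 'k"
  have [measurable_cong]: "sets ?M = sets (\<Pi>\<^sub>M i\<in>{..<n}. borel)"
    by (intro sets_PiM_cong sets_F) auto
  have [measurable]: "(\<lambda>z. R (fst z) (snd z) q) \<in> borel_measurable (?M \<Otimes>\<^sub>M ?M)" for q
    unfolding R_def by measurable
  have [measurable]: "(\<lambda>\<rho>. R \<pi> \<rho> q) \<in> borel_measurable ?M" for \<pi> q
    unfolding R_def by measurable
  have norm: "(norm (\<Sum>i<n. outer_product (\<pi> i) (\<rho> i) - H))\<^sup>2 = (\<Sum>q\<in>Q. (R \<pi> \<rho> q)\<^sup>2)" for \<pi> \<rho>
    by (simp add: norm_matrix_power2_entries H_def outer_product_def R_def Q_def)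
  have "(\<integral>\<^sup>+\<pi>. \<integral>\<^sup>+\<rho>. ennreal (C * exp (\<theta> * (norm (\<Sum>i<n. outer_product (\<pi> i) (\<rho> i) - H))\<^sup>2)) \<partial>?M \<partial>?M)
      \<le> (\<integral>\<^sup>+\<pi>. \<integral>\<^sup>+\<rho>. (\<Sum>q\<in>Q. ennreal (C / N) * ennreal (exp ((N * \<theta>) * (R \<pi> \<rho> q)\<^sup>2))) \<partial>?M \<partial>?M)"
  proof (intro nn_integral_mono)
    fix \<pi> \<rho>
    have "C * exp (\<theta> * (\<Sum>q\<in>Q. (R \<pi> \<rho> q)\<^sup>2)) \<le> C * (\<Sum>q\<in>Q. exp ((N * \<theta>) * (R \<pi> \<rho> q)\<^sup>2) / N)"
      using exp_sum_le_average[OF Q(1,2), of "\<lambda>q. \<theta> * (R \<pi> \<rho> q)\<^sup>2"] Q(3) C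
      by (intro mult_left_mono) (simp_all add: sum_distrib_left mult_ac)
    also have "\<dots> = (\<Sum>q\<in>Q. C / N * exp ((N * \<theta>) * (R \<pi> \<rho> q)\<^sup>2))"
      by (simp add: sum_distrib_left)
    also have "ennreal \<dots> = (\<Sum>q\<in>Q. ennreal (C / N) * ennreal (exp ((N * \<theta>) * (R \<pi> \<rho> q)\<^sup>2)))"
      using N C by (simp add: ennreal_mult[symmetric])
    finally show "ennreal (C * exp (\<theta> * (norm (\<Sum>i<n. outer_product (\<pi> i) (\<rho> i) - H))\<^sup>2)) \<le>
        (\<Sum>q\<in>Q. ennreal (C / N) * ennreal (exp ((N * \<theta>) * (R \<pi> \<rho> q)\<^sup>2)))"
      by (simp add: norm ennreal_leI)
  qed
  also have "\<dots> = (\<Sum>q\<in>Q. ennreal (C / N) * (\<integral>\<^sup>+\<pi>. \<integral>\<^sup>+\<rho>. ennreal (exp ((N * \<theta>) * (R \<pi> \<rho> q)\<^sup>2)) \<partial>?M \<partial>?M))"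
    by (simp add: nn_integral_sum nn_integral_cmult)
  also have "\<dots> \<le> (\<Sum>q\<in>Q. ennreal (C / N) * ?B)"
  proof (intro sum_mono mult_left_mono)
    fix q :: "'k \<times> 'k"
    show "(\<integral>\<^sup>+\<pi>. \<integral>\<^sup>+\<rho>. ennreal (exp ((N * \<theta>) * (R \<pi> \<rho> q)\<^sup>2)) \<partial>?M \<partial>?M) \<le> ?B"
      unfolding R_def using nn_integral_exp_entry_square_le[of "N * \<theta>" n "fst q" "snd q"] \<theta> N
      by (simp add: mult_ac)
  qed simp
  also have "\<dots> = ennreal (C * exp (N * (real n * \<theta>) / (1 - 2 * (N * (real n * \<theta>)))))"
    using Q N C by (simp add: ennreal_of_nat_eq_real_of_nat flip: ennreal_mult)
  finally show ?thesis .
qed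

end


section \<open>Bounding the chi-square distance\<close>

lemma chi_square_distance_nonneg: "chi_square_distance n P F \<ge> 0"
  unfolding chi_square_distance_def null_density_def by (intro sum_nonneg) simp

text \<open>
  If \<open>h \<bullet> P h = 0\<close> with nonnegative entries, then \<open>P $ k $ l\<close> can be nonzero only if \<open>h $ k\<close> or \<open>h $ l\<close>
  vanishes, and a coordinate with mean \<open>0\<close> vanishes almost surely. Hence all edge probabilities are
  almost surely \<open>0\<close> under the alternative as well, and the two densities agree.
\<close>
lemma chi_square_distance_eq_0:
  fixes P :: "real ^ 'k ^ 'k"
  assumes F: "distribution_on_simplex F" and P: "\<And>i j. P $ i $ j \<in> {0..1}"
    and a: "alpha0 P (mean_membership F) = 0"
  shows "chi_square_distance n P F = 0"
proof -
  let ?h = "mean_membership F" and ?M = "\<Pi>\<^sub>M i\<in>{..<n}. F"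
  interpret prob_space F
    using F by (simp add: distribution_on_simplex_def)
  interpret M: prob_space ?M
    by (intro prob_space_PiM prob_space_axioms)
  note [measurable_cong] = sets_F[OF F]
  note h = component_prob_simplex[OF mean_membership_prob_simplex[OF F]]
  have double_sum: "(\<Sum>k\<in>UNIV. \<Sum>l\<in>UNIV. ?h $ k * P $ k $ l * ?h $ l) = 0"
    using a by (simp add: alpha0_def inner_vec_def matrix_vector_mult_def sum_distrib_left mult.assoc)
  have zero: "?h $ k * P $ k $ l * ?h $ l = 0" for k l
  proof -
    have "\<forall>k\<in>UNIV. (\<Sum>l\<in>UNIV. ?h $ k * P $ k $ l * ?h $ l) = 0"
      using double_sum h P by (subst (asm) sum_nonneg_eq_0_iff) (auto intro!: sum_nonneg)
    then have "\<forall>l\<in>UNIV. ?h $ k * P $ k $ l * ?h $ l = 0"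
      using h P by (subst sum_nonneg_eq_0_iff[symmetric]) auto
    then show ?thesis by (rule bspec) simp
  qed
  have "AE x in F. ?h $ k = 0 \<longrightarrow> x $ k = 0" for k
  proof (cases "?h $ k = 0")
    case True
    have "AE x in F. 0 \<le> x $ k"
      using AE_prob_simplex[OF F] by eventually_elim (rule component_prob_simplex)
    then have "AE x in F. x $ k = 0"
      using True integral_nonneg_eq_0_iff_AE[OF integrable_component[OF F, of k]]
      by (simp add: mean_membership_component[OF F])
    then show ?thesis by eventually_elim simp
  qed simp
  then have "AE x in F. \<forall>k\<in>UNIV. ?h $ k = 0 \<longrightarrow> x $ k = 0"
    by (intro eventually_ball_finite) auto
  then have "AE \<pi> in ?M. \<forall>i\<in>{..<n}. \<forall>k\<in>UNIV. ?h $ k = 0 \<longrightarrow> \<pi> i $ k = 0"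
    by (intro eventually_ball_finite ballI AE_PiM_component prob_space_axioms) auto
  then have lik: "AE \<pi> in ?M. \<forall>i\<in>{..<n}. \<forall>j\<in>{..<n}. \<pi> i \<bullet> (P *v \<pi> j) = 0"
  proof eventually_elim
    fix \<pi> :: "nat \<Rightarrow> real ^ 'k"
    assume \<pi>: "\<forall>i\<in>{..<n}. \<forall>k\<in>UNIV. ?h $ k = 0 \<longrightarrow> \<pi> i $ k = 0"
    have "\<pi> i $ k * (P $ k $ l * \<pi> j $ l) = 0" if "i \<in> {..<n}" "j \<in> {..<n}" for i j k l
      using zero[of k l] \<pi> that by auto
    then show "\<forall>i\<in>{..<n}. \<forall>j\<in>{..<n}. \<pi> i \<bullet> (P *v \<pi> j) = 0"
      by (auto simp: inner_vec_def matrix_vector_mult_def sum_distrib_left intro!: sum.neutral)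
  qed
  have "alternative_density n P F A = null_density n P F A" if A: "A \<in> adjacency_matrices n" for A
  proof -
    have "alternative_density n P F A = (\<integral>\<pi>. null_density n P F A \<partial>?M)"
      unfolding alternative_density_def
    proof (rule integral_cong_AE)
      show "AE \<pi> in ?M. pmf (adjacency_pmf n (\<lambda>i j. \<pi> i \<bullet> (P *v \<pi> j))) A = null_density n P F A"
        using lik
      proof eventually_elim
        fix \<pi> :: "nat \<Rightarrow> real ^ 'k"
        assume "\<forall>i\<in>{..<n}. \<forall>j\<in>{..<n}. \<pi> i \<bullet> (P *v \<pi> j) = 0"
        then show "pmf (adjacency_pmf n (\<lambda>i j. \<pi> i \<bullet> (P *v \<pi> j))) A = null_density n P F A"
          unfolding null_density_def pmf_adjacency_pmf[OF A] a
          by (intro prod.cong) (auto simp: upper_pairs_def)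
      qed
    qed (use alternative_likelihood_measurable[OF sets_F[OF F] A] in auto)
    then show ?thesis by (simp add: M.prob_space)
  qed
  then show ?thesis
    unfolding chi_square_distance_def by (intro sum.neutral) auto
qed

text \<open>
  The bound for fixed \<open>n\<close>. The number \<open>e\<close> dominates \<open>n \<theta>\<close>, where \<open>\<theta>\<close> is the rate at which \<open>\<parallel>R\<parallel>\<^sup>2\<close>
  enters the exponent. It enters once as a deterministic part of the exponent, and once
  through the exponential moment of \<open>\<theta> \<parallel>R\<parallel>\<^sup>2\<close>. The first part of \<open>beta_n\<close> enters \<open>e\<close> linearly, the
  second one through its square root, because it is the square of \<open>n \<parallel>M\<parallel>\<^sup>2 / alpha0\<close>.
\<close>
lemma chi_square_distance_le:
  fixes P :: "real ^ 'k ^ 'k"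
  defines "N \<equiv> (real CARD('k))\<^sup>2"
  assumes F: "distribution_on_simplex F" and sym: "transpose P = P"
    and P: "\<And>i j. P $ i $ j \<in> {0..1}"
    and a: "0 < alpha0 P (mean_membership F)" "alpha0 P (mean_membership F) \<le> 1 - c" and c: "c > 0"
    and beta: "(beta_n n P (mean_membership F) + sqrt (beta_n n P (mean_membership F))) / (2 * c) \<le> e"
    and e: "2 * (N * e) < 1"
  shows "1 + chi_square_distance n P F \<le> exp (e + N * e / (1 - 2 * (N * e)))"
proof -
  define h where "h = mean_membership F"
  define \<alpha> where "\<alpha> = alpha0 P h"
  define M where "M = P - \<alpha> *\<^sub>R ones_mat"
  define m where "m = onorm ((*v) M)"
  define \<beta> where "\<beta> = beta_n n P h"
  define \<gamma> where "\<gamma> = 1 / (\<alpha> * (1 - \<alpha>))"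
  \<comment> \<open>The first summand is what remains of the linear term in \<open>\<parallel>R\<parallel>\<close> after completing the square.\<close>
  define \<theta> where "\<theta> = \<gamma> * (sqrt n * (norm (M *v h))\<^sup>2 + m\<^sup>2) / 2"
  let ?PM = "\<Pi>\<^sub>M i\<in>{..<n}. F"
  let ?R = "\<lambda>\<pi> \<rho>. \<Sum>i<n. outer_product (\<pi> i) (\<rho> i) - outer_product h h"
  have \<alpha>: "0 < \<alpha>" "\<alpha> < 1" "c \<le> 1 - \<alpha>"
    using a c by (auto simp: \<alpha>_def h_def)
  have \<gamma>: "0 \<le> \<gamma>" "\<gamma> \<le> 1 / (\<alpha> * c)"
    using \<alpha> c by (auto simp: \<gamma>_def intro!: divide_left_mono mult_left_mono)
  have h: "h \<in> prob_simplex"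
    unfolding h_def by (rule mean_membership_prob_simplex[OF F])
  have M_mult: "M *v x = P *v x - \<alpha> *\<^sub>R ones_vec" if "x \<in> prob_simplex" for x
    using that
    by (simp add: M_def vec_eq_iff matrix_vector_mult_def ones_mat_def ones_vec_def prob_simplex_def
        algebra_simps sum_subtractf flip: sum_distrib_left)
  have M_form: "x \<bullet> (M *v y) = x \<bullet> (P *v y) - \<alpha>" if "x \<in> prob_simplex" "y \<in> prob_simplex" for x y
  proof -
    have "x \<bullet> ones_vec = 1"
      using that(1) by (simp add: inner_vec_def ones_vec_def prob_simplex_def)
    then show ?thesis
      by (simp add: M_mult[OF that(2)] inner_diff_right)
  qed
  have M_h: "h \<bullet> (M *v h) = 0"
    using M_form[OF h h] by (simp add: \<alpha>_def alpha0_def)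
  have M_sym: "transpose M = M"
    using sym by (simp add: M_def transpose_def ones_mat_def vec_eq_iff)
  have \<theta>_nonneg: "\<theta> \<ge> 0"
    using \<gamma> by (simp add: \<theta>_def)
  have \<theta>_le: "real n * \<theta> \<le> e"
  proof -
    have powr: "real n powr (3/2) = real n * sqrt n"
      using powr_add[of "real n" 1 "1/2"] by (simp add: powr_half_sqrt)
    have "\<beta> \<ge> real n * sqrt n * (1 / \<alpha>) * (norm (M *v h))\<^sup>2"
      unfolding \<beta>_def beta_n_def M_mult[OF h] powr \<alpha>_def by (simp add: inverse_eq_divide)
    moreover have "\<beta> \<ge> (real n * (1 / \<alpha>) * m\<^sup>2)\<^sup>2"
      unfolding \<beta>_def beta_n_def m_def M_def \<alpha>_def
      by (simp add: inverse_eq_divide power_mult_distrib power_divide flip: power_mult)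
    then have "sqrt \<beta> \<ge> real n * (1 / \<alpha>) * m\<^sup>2"
      using \<alpha> by (simp add: real_le_rsqrt)
    ultimately have sum_le: "real n * (1 / \<alpha>) * (sqrt n * (norm (M *v h))\<^sup>2 + m\<^sup>2) \<le> \<beta> + sqrt \<beta>"
      by (simp add: algebra_simps)
    have "real n * \<theta> = \<gamma> * (real n * (sqrt n * (norm (M *v h))\<^sup>2 + m\<^sup>2) / 2)"
      by (simp add: \<theta>_def)
    also have "\<dots> \<le> 1 / (\<alpha> * c) * (real n * (sqrt n * (norm (M *v h))\<^sup>2 + m\<^sup>2) / 2)"
      by (intro mult_right_mono \<gamma>) simp
    also have "\<dots> = (real n * (1 / \<alpha>) * (sqrt n * (norm (M *v h))\<^sup>2 + m\<^sup>2)) / (2 * c)"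
      by (simp add: field_simps)
    also have "\<dots> \<le> (\<beta> + sqrt \<beta>) / (2 * c)"
      using c sum_le by (intro divide_right_mono) auto
    also have "\<dots> \<le> e"
      using beta by (simp add: \<beta>_def h_def)
    finally show ?thesis .
  qed
  have N: "N \<ge> 0" by (simp add: N_def)
  then have N_\<theta>: "N * (real n * \<theta>) \<le> N * e"
    using \<theta>_le by (rule mult_left_mono[rotated])
  then have N_\<theta>_less: "2 * (N * (real n * \<theta>)) < 1"
    using e by simp
  have pointwise: "(\<Sum>A\<in>adjacency_matrices n.
        pmf (adjacency_pmf n (\<lambda>i j. \<pi> i \<bullet> (P *v \<pi> j))) A *
        pmf (adjacency_pmf n (\<lambda>i j. \<rho> i \<bullet> (P *v \<rho> j))) A / null_density n P F A)
      \<le> exp e * exp (\<theta> * (norm (?R \<pi> \<rho>))\<^sup>2)"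
    if \<pi>: "\<forall>i\<in>{..<n}. \<pi> i \<in> prob_simplex" and \<rho>: "\<forall>i\<in>{..<n}. \<rho> i \<in> prob_simplex" for \<pi> \<rho>
  proof -
    let ?r = "norm (?R \<pi> \<rho>)" and ?v = "norm (M *v h)"
    have "(\<Sum>A\<in>adjacency_matrices n.
        pmf (adjacency_pmf n (\<lambda>i j. \<pi> i \<bullet> (P *v \<pi> j))) A *
        pmf (adjacency_pmf n (\<lambda>i j. \<rho> i \<bullet> (P *v \<rho> j))) A / null_density n P F A)
      \<le> exp ((\<Sum>(i, j)\<in>upper_pairs n. (\<pi> i \<bullet> (P *v \<pi> j) - \<alpha>) * (\<rho> i \<bullet> (P *v \<rho> j) - \<alpha>))
            / (\<alpha> * (1 - \<alpha>)))"
      unfolding null_density_def h_def[symmetric] \<alpha>_def[symmetric]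
      using \<pi> \<rho> by (intro sum_adjacency_pmf_mult_div_le_exp \<alpha> conjI quadratic_form_prob_simplex P)
        (auto simp: upper_pairs_def)
    also have "(\<Sum>(i, j)\<in>upper_pairs n. (\<pi> i \<bullet> (P *v \<pi> j) - \<alpha>) * (\<rho> i \<bullet> (P *v \<rho> j) - \<alpha>)) =
        (\<Sum>(i, j)\<in>upper_pairs n. (\<pi> i \<bullet> (M *v \<pi> j)) * (\<rho> i \<bullet> (M *v \<rho> j)))"
      using \<pi> \<rho> by (intro sum.cong) (auto simp: upper_pairs_def M_form)
    also have "\<dots> / (\<alpha> * (1 - \<alpha>)) \<le>
        (real n * ?v\<^sup>2 * ?r + m\<^sup>2 / 2 * ?r\<^sup>2 + real n * m\<^sup>2 / 2) / (\<alpha> * (1 - \<alpha>))"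
      unfolding m_def using \<pi> \<rho> \<alpha>
      by (intro divide_right_mono sum_upper_pairs_bilinear_product_le M_sym M_h) (auto intro: norm_prob_simplex_le)
    also have "\<dots> = \<gamma> * (?v\<^sup>2 * (real n * ?r) + m\<^sup>2 / 2 * ?r\<^sup>2 + real n * m\<^sup>2 / 2)"
      by (simp add: \<gamma>_def mult_ac)
    \<comment> \<open>The weight \<open>\<surd>n\<close> balances the two means, as \<open>?r\<close> is typically of order \<open>\<surd>n\<close>.\<close>
    also have "\<dots> \<le> \<gamma> * (?v\<^sup>2 * (sqrt n * (real n + ?r\<^sup>2) / 2) + m\<^sup>2 / 2 * ?r\<^sup>2 + real n * m\<^sup>2 / 2)"
    proof -
      have "0 \<le> sqrt n * (sqrt n - ?r)\<^sup>2" by simp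
      also have "\<dots> = sqrt n * (real n + ?r\<^sup>2) - 2 * (sqrt n * sqrt n) * ?r"
        by (simp add: power2_eq_square algebra_simps)
      finally have "real n * ?r \<le> sqrt n * (real n + ?r\<^sup>2) / 2"
        by simp
      then show ?thesis
        using \<gamma> by (intro mult_left_mono add_right_mono) auto
    qed
    also have "\<dots> = real n * \<theta> + \<theta> * ?r\<^sup>2"
      by (simp add: \<theta>_def field_simps)
    also have "\<dots> \<le> e + \<theta> * ?r\<^sup>2"
      using \<theta>_le by simp
    finally show ?thesis by (simp add: exp_add)
  qed
  note AE = AE_membership_prob_simplex[OF F, of n]
  have "ennreal (1 + chi_square_distance n P F) \<le>
      (\<integral>\<^sup>+\<pi>. \<integral>\<^sup>+\<rho>. ennreal (exp e * exp (\<theta> * (norm (?R \<pi> \<rho>))\<^sup>2)) \<partial>?PM \<partial>?PM)"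
    unfolding ennreal_chi_square_distance[OF F \<alpha>(1,2)[unfolded \<alpha>_def h_def]]
  proof (intro nn_integral_mono_AE, use AE in eventually_elim)
    fix \<pi> :: "nat \<Rightarrow> real ^ 'k" assume \<pi>: "\<forall>i\<in>{..<n}. \<pi> i \<in> prob_simplex"
    show "(\<integral>\<^sup>+\<rho>. ennreal (\<Sum>A\<in>adjacency_matrices n.
        pmf (adjacency_pmf n (\<lambda>i j. \<pi> i \<bullet> (P *v \<pi> j))) A *
        pmf (adjacency_pmf n (\<lambda>i j. \<rho> i \<bullet> (P *v \<rho> j))) A / null_density n P F A) \<partial>?PM)
      \<le> (\<integral>\<^sup>+\<rho>. ennreal (exp e * exp (\<theta> * (norm (?R \<pi> \<rho>))\<^sup>2)) \<partial>?PM)"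
      using AE by (intro nn_integral_mono_AE) (auto elim!: eventually_mono intro!: ennreal_leI pointwise \<pi>)
  qed
  also have "\<dots> \<le> ennreal (exp e * exp (N * (real n * \<theta>) / (1 - 2 * (N * (real n * \<theta>)))))"
    using nn_integral_exp_norm_square_le[OF F _ \<theta>_nonneg N_\<theta>_less[unfolded N_def], of "exp e"]
    by (simp add: h_def N_def)
  also have "\<dots> \<le> ennreal (exp e * exp (N * e / (1 - 2 * (N * e))))"
  proof -
    have "0 \<le> N * e"
      using N \<theta>_nonneg by (intro order.trans[OF _ N_\<theta>]) simp
    then show ?thesis
      using N_\<theta> e by (intro ennreal_leI mult_left_mono) (auto intro!: frac_le)
  qed
  also have "\<dots> = ennreal (exp (e + N * e / (1 - 2 * (N * e))))"
    by (simp add: exp_add)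
  finally show ?thesis
    by (simp add: ennreal_le_iff)
qed

theorem theorem3p5:
  fixes P :: "nat \<Rightarrow> real ^ 'k ^ 'k"
    and F :: "nat \<Rightarrow> (real ^ 'k) measure"
    and h :: "nat \<Rightarrow> real ^ 'k"
    and c :: real
  assumes K: "CARD('k) \<ge> 2"
    and P_sym: "\<And>n. transpose (P n) = P n"
    and P_range: "\<And>n i j. P n $ i $ j \<in> {0..1}"
    and F: "\<And>n. distribution_on_simplex (F n)"
    and h: "\<And>n. h n = mean_membership (F n)"
    and alpha0_bound: "c > 0" "eventually (\<lambda>n. alpha0 (P n) (h n) \<le> 1 - c) sequentially"
    and beta: "(\<lambda>n. beta_n n (P n) (h n)) \<longlonglongrightarrow> 0"
  shows "(\<lambda>n. chi_square_distance n (P n) (F n)) \<longlonglongrightarrow> 0"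
proof -
  define N where "N = (real CARD('k))\<^sup>2"
  define e where "e n = (beta_n n (P n) (h n) + sqrt (beta_n n (P n) (h n))) / (2 * c)" for n
  have e: "e \<longlonglongrightarrow> 0"
    unfolding e_def using beta alpha0_bound(1) by (auto intro!: tendsto_eq_intros)
  have "(\<lambda>n. 2 * (N * e n)) \<longlonglongrightarrow> 0"
    using e by (auto intro!: tendsto_eq_intros)
  then have small: "eventually (\<lambda>n. 2 * (N * e n) < 1) sequentially"
    by (rule order_tendstoD) simp
  have bound: "(\<lambda>n. exp (e n + N * e n / (1 - 2 * (N * e n))) - 1) \<longlonglongrightarrow> 0"
    using e by (auto intro!: tendsto_eq_intros)
  have "eventually (\<lambda>n. chi_square_distance n (P n) (F n) \<le>
      exp (e n + N * e n / (1 - 2 * (N * e n))) - 1) sequentially"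
    using small alpha0_bound(2)
  proof eventually_elim
    fix n :: nat assume n: "2 * (N * e n) < 1" "alpha0 (P n) (h n) \<le> 1 - c"
    have a: "alpha0 (P n) (h n) \<ge> 0"
      using quadratic_form_prob_simplex[OF P_range mean_membership_prob_simplex[OF F]
          mean_membership_prob_simplex[OF F]]
      by (simp add: alpha0_def h)
    show "chi_square_distance n (P n) (F n) \<le> exp (e n + N * e n / (1 - 2 * (N * e n))) - 1"
    proof (cases "alpha0 (P n) (h n) = 0")
      case True
      have "0 \<le> beta_n n (P n) (h n)"
        unfolding beta_n_def by (rule max.coboundedI2) simp
      then have "0 \<le> e n" using alpha0_bound(1) by (simp add: e_def)
      then have "0 \<le> e n + N * e n / (1 - 2 * (N * e n))"
        using n(1) by (simp add: N_def)
      then show ?thesis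
        using chi_square_distance_eq_0[OF F P_range] True by (simp add: h)
    next
      case False
      then show ?thesis
        using chi_square_distance_le[where F = "F n" and P = "P n" and n = n and c = c and e = "e n"]
          F P_sym P_range a n alpha0_bound(1)
        by (simp add: h e_def N_def)
    qed
  qed
  then show ?thesis
    by (intro tendsto_sandwich[OF _ _ tendsto_const bound]) (simp_all add: chi_square_distance_nonneg)
qed

end
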